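(* Let $G$ be a finite pseudo-solvable group, and let $\overline{\Gamma}(G)$ be the complement of its prime graph. Then at least one of the following holds. (1) $\{2,3,5\}$ does not form a triangle in $\overline{\Gamma}(G)$. (2) For every prime $p\notin\{2,3,5\}$, the pair $2$-$p$ is not an edge in $\overline{\Gamma}(G)$.
   Context: The prime graph of a finite group $G$ has as vertices the primes dividing $|G|$, with two distinct primes $p,q$ adjacent if and only if $G$ contains an element of order $pq$; $\overline{\Gamma}(G)$ denotes its complement. A finite group is called pseudo-solvable if each of its composition factors is either cyclic or isomorphic to the alternating group $A_5$. To say that $\{2,3,5\}$ forms a triangle in $\overline{\Gamma}(G)$ means that $2,3,5$ are all vertices and are pairwise adjacent in $\overline{\Gamma}(G)$. *)

theory Defs
  imports "HOL-Algebra.Algebra" "Graph_Theory.Pair_Digraph"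
begin

hide_const (open) Divisibility.prime

text \<open>Undirected simple graphs are represented as symmetric loop-free pair digraphs: the edge
  \<open>u\<close>-\<open>v\<close> is the pair of arcs \<open>(u, v)\<close> and \<open>(v, u)\<close>.\<close>

definition prime_graph :: "('a, 'b) monoid_scheme \<Rightarrow> nat pair_pre_digraph" where
  "prime_graph G =
     (let V = {p. prime p \<and> p dvd order G} in
      \<lparr> pverts = V,
        parcs = {(p, q). p \<in> V \<and> q \<in> V \<and> p \<noteq> q \<and>
                         (\<exists>x \<in> carrier G. group.ord G x = p * q)} \<rparr>)"

definition graph_complement :: "'v pair_pre_digraph \<Rightarrow> 'v pair_pre_digraph" where
  "graph_complement \<Gamma> =
     \<lparr> pverts = pverts \<Gamma>,
       parcs = {(u, v). u \<in> pverts \<Gamma> \<and> v \<in> pverts \<Gamma> \<and> u \<noteq> v \<and> (u, v) \<notin> parcs \<Gamma>} \<rparr>"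

definition forms_triangle :: "'v set \<Rightarrow> 'v pair_pre_digraph \<Rightarrow> bool" where
  "forms_triangle S \<Gamma> \<longleftrightarrow>
     card S = 3 \<and> S \<subseteq> pverts \<Gamma> \<and> (\<forall>u \<in> S. \<forall>v \<in> S. u \<noteq> v \<longrightarrow> (u, v) \<in> parcs \<Gamma>)"

lemma pair_graph_prime_graph:
  assumes "group G" "finite (carrier G)"
  shows "pair_graph (prime_graph G)"
proof -
  have "order G > 0"
    using assms by (simp add: group.is_monoid monoid.order_gt_0_iff_finite)
  then have fin: "finite {p. prime p \<and> p dvd order G}"
    by (intro finite_subset[OF _ finite_divisors_nat[of "order G"]]) auto
  have "finite (parcs (prime_graph G))"
    by (rule finite_subset[OF _ finite_cartesian_product[OF fin fin]])
      (auto simp: prime_graph_def Let_def)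
  with fin show ?thesis
    by unfold_locales (auto simp: prime_graph_def Let_def symmetric_def sym_def mult.commute)
qed

text \<open>A composition series is listed in ascending order, from the trivial subgroup to the whole
  group. Every member is a subgroup of \<open>G\<close>, since normality in the next member
  includes being a subgroup of it.\<close>

definition composition_series :: "('a, 'b) monoid_scheme \<Rightarrow> 'a set list \<Rightarrow> bool" where
  "composition_series G Hs \<longleftrightarrow>
     Hs \<noteq> [] \<and> hd Hs = {\<one>\<^bsub>G\<^esub>} \<and> last Hs = carrier G \<and>
     (\<forall>i. Suc i < length Hs \<longrightarrow>
        Hs ! i \<lhd> G\<lparr>carrier := Hs ! Suc i\<rparr> \<and>
        simple_group (G\<lparr>carrier := Hs ! Suc i\<rparr> Mod Hs ! i))"

definition composition_factors :: "('a, 'b) monoid_scheme \<Rightarrow> 'a set monoid set" where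
  "composition_factors G =
     {G\<lparr>carrier := Hs ! Suc i\<rparr> Mod Hs ! i | Hs i. composition_series G Hs \<and> Suc i < length Hs}"

definition pseudo_solvable :: "('a, 'b) monoid_scheme \<Rightarrow> bool" where
  "pseudo_solvable G \<longleftrightarrow>
     group G \<and> finite (carrier G) \<and>
     (\<forall>K \<in> composition_factors G. cyclic_group K \<or> K \<cong> alt_group 5)"

end

theory Submission
  imports Defs
begin

text \<open>
Suppose that \<open>G\<close> has no element of order 6, 10 or 15, that its order is divisible by 30, and that
some prime \<open>p\<close> outside \<open>{2, 3, 5}\<close> divides it while no element has order \<open>2 * p\<close>. All these conditions
are inherited by the quotients of \<open>G\<close> whose order is still divisible by the primes in question, because
an element of a quotient lifts to an element whose order is a multiple. So in each of the two cases below
one divides by a normal subgroup that is maximal subject to keeping what is needed, and then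
looks at the small normal subgroups of the quotient.

Two mechanisms produce elements of composite order. First, let \<open>E\<close> be an abelian normal subgroup of
odd prime exponent \<open>q\<close>. An involution that fixes no nontrivial element of \<open>E\<close> inverts \<open>E\<close>, and inversion
commutes with every automorphism, so the involution is central modulo the centralizer \<open>C\<close> of \<open>E\<close>.
Hence each odd prime that divides the index of \<open>C\<close> yields an element of twice that order
(\<open>exists_ord_of_involution_inverting\<close>). Secondly, let the nontrivial elements of a group \<open>Y\<close>
act on a group \<open>Q\<close> without nontrivial fixed points. Then the semidirect product of \<open>Q\<close> by \<open>Y\<close> cannot act on
a nontrivial abelian group of exponent prime to \<open>card Q\<close> in such a way that some element of \<open>Q\<close> and some
element of \<open>Y\<close> fix nothing but the identity (\<open>frobenius_action_exponent\<close>).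

If \<open>G\<close> is solvable, the quotient has an abelian normal subgroup \<open>E \<noteq> 1\<close> of exponent 2, 3 or 5. For 3 and 5 the first
mechanism applies. For 2 one finds, from the derived series and a Frattini argument, a 3-subgroup
normalized by an element of order 5 or the reverse, and the second mechanism applies. Thus 30
dividing the order of a solvable group already forces an element of order 6, 10 or 15
(\<open>solvable_exists_ord_6_10_15\<close>).

If \<open>G\<close> is not solvable, the derived series ends in a perfect normal subgroup \<open>D \<noteq> 1\<close>, and one keeps
\<open>D\<close> and \<open>p\<close> visible in the quotient. Let \<open>N\<close> be a minimal normal subgroup of the quotient. If \<open>N\<close> is
abelian, then \<open>p\<close> divides \<open>card N\<close>; the first mechanism applies to the \<open>p\<close>-torsion of \<open>N\<close> and gives an
element of order 6, since the image of \<open>D\<close> modulo an odd order centralizer still has order divisible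
by 60. If \<open>N\<close> is perfect, its simple quotients have order 60. Two different kernels would give a quotient
of \<open>N\<close> with two commuting factors of order 60, and so an element of order 6; hence \<open>N\<close> itself has order
60. A Frattini argument then gives an element \<open>x\<close> of order \<open>p\<close> that normalizes a Sylow 2-subgroup of
\<open>N\<close>, which has order 4. As \<open>p > 3\<close>, this element centralizes an involution or an element of order 4, and
an element of order \<open>2 * p\<close> results.

Of pseudo-solvability the argument retains only this: whenever \<open>L\<close> is a maximal normal subgroup of a
normal subgroup \<open>N\<close>, the index of \<open>L\<close> in \<open>N\<close> is a prime or 60 (\<open>prime_or_60_heads\<close>). It holds because every
such pair \<open>L\<close>, \<open>N\<close> can be refined to a composition series of \<open>G\<close>. Unlike a statement about one chosen series
it passes to quotients directly, by taking preimages.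
\<close>

section \<open>Orders of elements\<close>

lemma (in group) exists_ord_of_dvd:
  assumes "x \<in> carrier G" "m dvd ord x" "ord x \<noteq> 0"
  shows "\<exists>y\<in>carrier G. ord y = m"
proof -
  obtain k where k: "ord x = k * m" "k \<noteq> 0" "m \<noteq> 0"
    using assms(2,3) by (auto elim!: dvdE simp: mult.commute)
  then have "ord (x [^] k) = m"
    using assms(1) by (simp add: ord_pow)
  then show ?thesis
    using assms(1) nat_pow_closed by blast
qed

lemma (in group) ord_subgroup:
  assumes "subgroup H G" "x \<in> H"
  shows "group.ord (G\<lparr>carrier := H\<rparr>) x = ord x"
  unfolding group.ord_def[OF subgroup_imp_group[OF assms(1)]] ord_def
    nat_pow_consistent[of x _ H, symmetric] by simp

text \<open>For commuting factors of coprime orders, raising the product to the power \<open>ord (x \<otimes> y) * ord y\<close>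
removes the second factor; this shows that \<open>ord x\<close> divides \<open>ord (x \<otimes> y)\<close>, and symmetrically for \<open>ord y\<close>.\<close>

lemma (in group) ord_mult_commuting_primes:
  assumes "x \<in> carrier G" "y \<in> carrier G" "x \<otimes> y = y \<otimes> x"
    and "prime (ord x)" "prime (ord y)" "ord x \<noteq> ord y"
  shows "ord (x \<otimes> y) = ord x * ord y"
proof (rule dvd_antisym)
  show "ord (x \<otimes> y) dvd ord x * ord y"
    using assms(1-3) by (intro ord_mul_divides)
  have cop: "coprime (ord x) (ord y)"
    using assms(4-6) by (rule primes_coprime)
  have dvd: "ord u dvd ord (u \<otimes> v)"
    if "u \<in> carrier G" "v \<in> carrier G" "u \<otimes> v = v \<otimes> u" "coprime (ord u) (ord v)" for u v
  proof -
    let ?n = "ord (u \<otimes> v) * ord v"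
    have "(u \<otimes> v) [^] ?n = \<one>" "v [^] ?n = \<one>"
      using that(1,2) pow_eq_id[of "u \<otimes> v" ?n] pow_eq_id[of v ?n] by simp_all
    moreover have "(u \<otimes> v) [^] ?n = u [^] ?n \<otimes> v [^] ?n"
      using that(1-3) by (intro pow_mult_distrib)
    ultimately have "u [^] ?n = \<one>"
      using that(1) by simp
    then have "ord u dvd ?n"
      using that(1) pow_eq_id[of u ?n] by simp
    then show ?thesis
      using that(4) by (simp add: coprime_dvd_mult_left_iff)
  qed
  have "ord x dvd ord (x \<otimes> y)"
    using dvd[of x y] assms(1-3) cop by simp
  moreover have "ord y dvd ord (x \<otimes> y)"
    using dvd[of y x] assms(1-3) cop by (simp add: coprime_commute)
  ultimately show "ord x * ord y dvd ord (x \<otimes> y)"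
    using cop by (rule divides_mult)
qed

lemma (in group) ord_eq_primeI:
  assumes "x \<in> carrier G" "x \<noteq> \<one>" "x [^] p = \<one>" "prime p"
  shows "ord x = p"
proof -
  have "ord x dvd p" "ord x \<noteq> 1"
    using assms(1-3) pow_eq_id[of x p] ord_eq_1[of x] by simp_all
  then show ?thesis using assms(4) by (auto simp: prime_nat_iff)
qed

lemma (in normal) rcoset_eq_self_iff: "x \<in> carrier G \<Longrightarrow> H #> x = H \<longleftrightarrow> x \<in> H"
  using subgroup_axioms by (metis coset_join1 coset_join2)

lemma (in normal) order_quotient: "order (G Mod H) * card H = order G"
  using lagrange[OF subgroup_axioms] by (simp add: order_def FactGroup_def)

text \<open>A representative of a coset has an order that is a multiple of the order of the coset, so a
suitable power of it has exactly that order. Edges of the prime graph of a quotient are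
therefore edges of the prime graph of the group.\<close>

lemma (in normal) exists_ord_of_quotient:
  assumes "finite (carrier G)" "C \<in> carrier (G Mod H)"
  shows "\<exists>y\<in>carrier G. ord y = group.ord (G Mod H) C"
proof -
  obtain x where x: "x \<in> carrier G" "C = H #> x"
    using assms(2) by (auto simp: carrier_FactGroup)
  interpret Q: group "G Mod H" by (rule factorgroup_is_group)
  have "C [^]\<^bsub>G Mod H\<^esub> ord x = H #> (x [^] ord x)"
    using x by (simp add: FactGroup_pow)
  also have "\<dots> = H"
    using x by (simp add: coset_mult_one[OF subset])
  finally have "Q.ord C dvd ord x"
    using assms Q.pow_eq_id[of C "ord x"] by simp
  moreover have "ord x \<noteq> 0"
    using x ord_ge_1[OF assms(1), of x] by simp
  ultimately show ?thesis
    by (rule exists_ord_of_dvd[OF x(1)])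
qed

text \<open>The main source of elements whose order is a product of two primes: it is enough that two elements
commute modulo a normal subgroup and have the two prime orders there.\<close>

lemma (in normal) exists_ord_of_commuting_cosets:
  assumes "finite (carrier G)" "x \<in> carrier G" "y \<in> carrier G"
    and comm: "x \<otimes> y \<otimes> inv x \<otimes> inv y \<in> H"
    and "x \<notin> H" "y \<notin> H" "x [^] r \<in> H" "y [^] s \<in> H"
    and "prime r" "prime s" "r \<noteq> s"
  shows "\<exists>g\<in>carrier G. ord g = r * s"
proof -
  interpret Q: group "G Mod H" by (rule factorgroup_is_group)
  have car: "H #> x \<in> carrier (G Mod H)" "H #> y \<in> carrier (G Mod H)"
    using assms by (auto simp: carrier_FactGroup)
  have ox: "Q.ord (H #> x) = r"
    using assms car by (intro Q.ord_eq_primeI) (simp_all add: rcoset_eq_self_iff FactGroup_pow)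
  have oy: "Q.ord (H #> y) = s"
    using assms car by (intro Q.ord_eq_primeI) (simp_all add: rcoset_eq_self_iff FactGroup_pow)
  have "(x \<otimes> y) \<otimes> inv (y \<otimes> x) \<in> H"
    using comm assms(2,3) by (simp add: inv_mult_group m_assoc)
  then have "H #> (x \<otimes> y) = H #> (y \<otimes> x)"
    using assms(2,3) rcos_module_rev[OF is_group, of "y \<otimes> x" "x \<otimes> y"]
    by (simp add: repr_independence[OF _ _ subgroup_axioms])
  then have "(H #> x) \<otimes>\<^bsub>G Mod H\<^esub> (H #> y) = (H #> y) \<otimes>\<^bsub>G Mod H\<^esub> (H #> x)"
    using assms(2,3) by (simp add: rcos_sum)
  then have ord: "Q.ord ((H #> x) \<otimes>\<^bsub>G Mod H\<^esub> (H #> y)) = r * s"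
    using Q.ord_mult_commuting_primes[OF car] ox oy assms(9-11) by simp
  show ?thesis
    using exists_ord_of_quotient[OF assms(1) Q.m_closed[OF car]] unfolding ord .
qed

lemma (in group) exists_ord_of_commuting:
  assumes "finite (carrier G)" "x \<in> carrier G" "y \<in> carrier G" "x \<otimes> y = y \<otimes> x"
    and "prime r" "prime s" "r \<noteq> s" "r dvd ord x" "s dvd ord y"
  shows "\<exists>g\<in>carrier G. ord g = r * s"
proof -
  let ?x = "x [^] (ord x div r)" and ?y = "y [^] (ord y div s)"
  have pos: "ord x \<noteq> 0" "ord y \<noteq> 0"
    using ord_ge_1[OF assms(1)] assms(2,3) by fastforce+
  have ox: "ord ?x = r"
    using assms pos by (subst ord_pow) (auto simp: div_dvd_iff_mult dvd_div_eq_0_iff)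
  have oy: "ord ?y = s"
    using assms pos by (subst ord_pow) (auto simp: div_dvd_iff_mult dvd_div_eq_0_iff)
  have "?x \<otimes> y = y \<otimes> ?x"
    using assms(2-4) by (metis group_commutes_pow)
  then have "?x \<otimes> ?y = ?y \<otimes> ?x"
    using assms(2,3) by (metis group_commutes_pow nat_pow_closed)
  then have "ord (?x \<otimes> ?y) = r * s"
    using ord_mult_commuting_primes[of ?x ?y] assms ox oy by simp
  then show ?thesis using assms by blast
qed

lemma (in group) cauchy:
  assumes "finite (carrier G)" "prime p" "p dvd order G"
  shows "\<exists>x\<in>carrier G. ord x = p"
proof -
  obtain m where "order G = p ^ 1 * m"
    using assms(3) by auto
  then obtain H where H: "subgroup H G" "card H = p"
    using sylow_thm[OF assms(2) is_group _ assms(1), of 1 m] by auto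
  have "card H > 1"
    using H assms prime_gt_1_nat by simp
  then obtain x where x: "x \<in> H" "x \<noteq> \<one>"
    by (metis One_nat_def card.empty card_1_singleton_iff card_gt_0_iff is_singletonI' is_singleton_altdef less_irrefl less_numeral_extra(1) less_trans)
  have "x [^]\<^bsub>G\<lparr>carrier := H\<rparr>\<^esub> order (G\<lparr>carrier := H\<rparr>) = \<one>"
    using group.pow_order_eq_1[OF subgroup_imp_group[OF H(1)], of x] x by simp
  then have "x [^] p = \<one>"
    using H by (simp add: order_def flip: nat_pow_consistent)
  then show ?thesis
    using x H subgroup.mem_carrier ord_eq_primeI assms(2) by metis
qed

text \<open>Cauchy's theorem in the quotient by \<open>H\<close>. Divisibility of the index by \<open>p\<close> is written as a product on the
left, which avoids division of natural numbers.\<close>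

lemma (in normal) cauchy_modulo:
  assumes "finite (carrier G)" "prime p" "p * card H dvd order G"
  shows "\<exists>x\<in>carrier G. x \<notin> H \<and> x [^] p \<in> H"
proof -
  interpret Q: group "G Mod H" by (rule factorgroup_is_group)
  have "p dvd order (G Mod H)"
    using assms(3) finite_imp_card_positive[OF assms(1)] unfolding order_quotient[symmetric] by simp
  moreover have "finite (carrier (G Mod H))"
    using assms by (simp add: carrier_FactGroup)
  ultimately obtain C where C: "C \<in> carrier (G Mod H)" "Q.ord C = p"
    using Q.cauchy assms by blast
  obtain x where x: "x \<in> carrier G" "C = H #> x"
    using C(1) by (auto simp: carrier_FactGroup)
  have "C \<noteq> H"
    using C assms(2) Q.ord_id by auto
  moreover have "C [^]\<^bsub>G Mod H\<^esub> p = H"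
    using C Q.pow_ord_eq_1 by auto
  ultimately show ?thesis
    using x rcoset_eq_self_iff by (auto simp: FactGroup_pow)
qed

section \<open>Sylow conjugacy and the Frattini argument\<close>

lemma group_actionI:
  assumes "group G"
    and closed: "\<And>g e. g \<in> carrier G \<Longrightarrow> e \<in> E \<Longrightarrow> f g e \<in> E"
    and one: "\<And>e. e \<in> E \<Longrightarrow> f \<one>\<^bsub>G\<^esub> e = e"
    and mult: "\<And>g h e. g \<in> carrier G \<Longrightarrow> h \<in> carrier G \<Longrightarrow> e \<in> E \<Longrightarrow> f (g \<otimes>\<^bsub>G\<^esub> h) e = f g (f h e)"
  shows "group_action G E (\<lambda>g. \<lambda>e\<in>E. f g e)"
proof -
  interpret group G by fact
  have inv: "f g (f (inv\<^bsub>G\<^esub> g) e) = e" "f (inv\<^bsub>G\<^esub> g) (f g e) = e" if "g \<in> carrier G" "e \<in> E" for g e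
    using that mult[of g "inv\<^bsub>G\<^esub> g" e] mult[of "inv\<^bsub>G\<^esub> g" g e] one by auto
  have bij: "restrict (f g) E \<in> Bij E" if g: "g \<in> carrier G" for g
    unfolding Bij_def
  proof (intro IntI CollectI)
    show "bij_betw (restrict (f g) E) E E"
      by (rule bij_betwI[where g = "f (inv\<^bsub>G\<^esub> g)"]) (use g closed inv in auto)
  qed simp
  have "(\<lambda>g. restrict (f g) E) \<in> hom G (BijGroup E)"
  proof (rule homI)
    fix g h assume gh: "g \<in> carrier G" "h \<in> carrier G"
    show "restrict (f (g \<otimes>\<^bsub>G\<^esub> h)) E = restrict (f g) E \<otimes>\<^bsub>BijGroup E\<^esub> restrict (f h) E"
      using gh bij closed mult by (auto simp: BijGroup_def compose_def)
  qed (simp add: BijGroup_def bij)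
  then show ?thesis
    by (simp add: group_action_def group_hom_def group_hom_axioms_def group_BijGroup is_group)
qed

text \<open>Every orbit has a size dividing \<open>q ^ a\<close>. Without fixed points no orbit has size 1, so all the
sizes, and with them the cardinality of \<open>E\<close>, would be divisible by \<open>q\<close>.\<close>

lemma prime_power_action_fixed_point:
  assumes "group G" "order G = q ^ a" "prime q" "finite E" "\<not> q dvd card E"
    and closed: "\<And>g e. g \<in> carrier G \<Longrightarrow> e \<in> E \<Longrightarrow> f g e \<in> E"
    and one: "\<And>e. e \<in> E \<Longrightarrow> f \<one>\<^bsub>G\<^esub> e = e"
    and mult: "\<And>g h e. g \<in> carrier G \<Longrightarrow> h \<in> carrier G \<Longrightarrow> e \<in> E \<Longrightarrow> f (g \<otimes>\<^bsub>G\<^esub> h) e = f g (f h e)"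
  shows "\<exists>e\<in>E. \<forall>g\<in>carrier G. f g e = e"
proof (rule ccontr)
  assume nofix: "\<not> ?thesis"
  let ?\<phi> = "\<lambda>g. \<lambda>e\<in>E. f g e"
  interpret group_action G E ?\<phi>
    by (rule group_actionI[OF assms(1) closed one mult])
  have dvd: "q dvd card orb" if "orb \<in> orbits G E ?\<phi>" for orb
  proof -
    obtain e where e: "e \<in> E" "orb = orbit G ?\<phi> e"
      using \<open>orb \<in> _\<close> by (auto simp: orbits_def)
    have "card orb dvd q ^ a"
      using orbit_stabilizer_theorem[OF e(1)] e(2) assms(2) by (metis dvd_triv_left)
    then obtain i where i: "card orb = q ^ i"
      using assms(3) by (auto simp: divides_primepow_nat)
    have "i \<noteq> 0"
    proof
      assume "i = 0"
      then have "card orb = 1" using i by simp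
      moreover have "e \<in> orb"
        using e orbit_refl by simp
      ultimately have "orb = {e}"
        by (metis card_1_singletonE singletonD)
      then have "\<forall>g\<in>carrier G. f g e = e"
        using e by (auto simp: orbit_def)
      then show False
        using nofix e(1) by blast
    qed
    then show ?thesis using i by simp
  qed
  have "(\<Sum>orb\<in>orbits G E ?\<phi>. \<Sum>x\<in>orb. (1::nat)) = (\<Sum>x\<in>E. 1)"
    by (rule disjoint_sum[OF assms(4)])
  then have "(\<Sum>orb\<in>orbits G E ?\<phi>. card orb) = card E"
    by simp
  then have "q dvd card E"
    using dvd by (metis (no_types, lifting) dvd_sum)
  then show False using assms(5) by simp
qed

text \<open>Sylow's conjugacy theorem: \<open>P\<close> acts by right multiplication on the cosets of \<open>S\<close>, whose number is prime to
\<open>q\<close>, and a coset fixed by \<open>P\<close> gives an element that conjugates \<open>P\<close> into \<open>S\<close>.\<close>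

lemma (in group) prime_power_subgroup_conjugate_into:
  assumes "finite (carrier G)" "subgroup S G" "subgroup P G"
    and "card P = q ^ b" "prime q" "\<not> q * card S dvd order G"
  shows "\<exists>n\<in>carrier G. \<forall>s\<in>P. n \<otimes> s \<otimes> inv n \<in> S"
proof -
  interpret S: subgroup S G by fact
  interpret P: subgroup P G by fact
  have "card (rcosets S) * card S = order G"
    by (rule lagrange[OF assms(2)])
  then have nd: "\<not> q dvd card (rcosets S)"
    using assms(6) by (metis mult_dvd_mono dvd_refl)
  have fin: "finite (rcosets S)"
    using assms(1) by (simp add: RCOSETS_def)
  \<comment> \<open>Inverses make multiplication on the right a left action.\<close>
  have "\<exists>A\<in>rcosets S. \<forall>g\<in>carrier (G\<lparr>carrier := P\<rparr>). A #> inv g = A"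
  proof (rule prime_power_action_fixed_point[OF subgroup_imp_group[OF assms(3)] _ assms(5) fin nd])
    show "order (G\<lparr>carrier := P\<rparr>) = q ^ b"
      by (simp add: order_def assms(4))
  next
    fix g A assume "g \<in> carrier (G\<lparr>carrier := P\<rparr>)" "A \<in> rcosets S"
    then show "A #> inv g \<in> rcosets S"
      by (auto simp: RCOSETS_def coset_mult_assoc S.subset)
  next
    fix A assume "A \<in> rcosets S"
    then show "A #> inv \<one>\<^bsub>G\<lparr>carrier := P\<rparr>\<^esub> = A"
      using S.rcosets_carrier[OF is_group] by (simp add: coset_mult_one)
  next
    fix g h A assume *: "g \<in> carrier (G\<lparr>carrier := P\<rparr>)" "h \<in> carrier (G\<lparr>carrier := P\<rparr>)" "A \<in> rcosets S"
    then have "A \<subseteq> carrier G"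
      using S.rcosets_carrier[OF is_group] by blast
    then show "A #> inv (g \<otimes>\<^bsub>G\<lparr>carrier := P\<rparr>\<^esub> h) = A #> inv h #> inv g"
      using * by (simp add: inv_mult_group coset_mult_assoc)
  qed
  then obtain n where n: "n \<in> carrier G" "\<And>g. g \<in> P \<Longrightarrow> S #> n #> inv g = S #> n"
    by (auto simp: RCOSETS_def)
  have "n \<otimes> s \<otimes> inv n \<in> S" if "s \<in> P" for s
  proof -
    have "n \<in> S #> n"
      using n(1) assms(2) by (rule rcos_self)
    then have "n \<otimes> s \<in> S #> n #> s"
      unfolding r_coset_def[of _ _ s] by blast
    also have "S #> n #> s = S #> n #> inv (inv s)"
      using that by simp
    also have "S #> n #> inv (inv s) = S #> n"
      using that by (intro n(2)) simp
    finally show ?thesis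
      using n(1) that by (intro S.rcos_module_imp[OF is_group]) auto
  qed
  then show ?thesis using n(1) by blast
qed

definition (in group) conjugate :: "'a \<Rightarrow> 'a set \<Rightarrow> 'a set" where
  "conjugate g A = (\<lambda>a. g \<otimes> a \<otimes> inv g) ` A"

lemma (in group) conjugate_mult:
  assumes "g \<in> carrier G" "h \<in> carrier G" "A \<subseteq> carrier G"
  shows "conjugate (g \<otimes> h) A = conjugate g (conjugate h A)"
  unfolding conjugate_def image_image
  by (rule image_cong[OF refl]) (use assms in \<open>auto simp: inv_mult_group m_assoc subset_iff\<close>)

lemma (in group) conjugate_one: "A \<subseteq> carrier G \<Longrightarrow> conjugate \<one> A = A"
  by (force simp: conjugate_def)

lemma (in group) conjugate_closed: "A \<subseteq> carrier G \<Longrightarrow> g \<in> carrier G \<Longrightarrow> conjugate g A \<subseteq> carrier G"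
  by (auto simp: conjugate_def)

lemma (in group) conjugate_inverse:
  assumes "g \<in> carrier G" "A \<subseteq> carrier G"
  shows "conjugate (inv g) (conjugate g A) = A"
  using assms conjugate_mult[of "inv g" g A] by (simp add: conjugate_one)

lemma (in group) card_conjugate:
  assumes "g \<in> carrier G" "A \<subseteq> carrier G"
  shows "card (conjugate g A) = card A"
  unfolding conjugate_def using assms by (intro card_image inj_onI) (auto simp: subset_iff)

lemma (in group) subgroup_conjugate:
  assumes "g \<in> carrier G" "subgroup A G"
  shows "subgroup (conjugate g A) G"
proof (rule subgroupI)
  interpret A: subgroup A G by fact
  show "conjugate g A \<subseteq> carrier G"
    using assms(1) A.subset by (rule conjugate_closed[rotated])
  show "conjugate g A \<noteq> {}"
    using A.one_closed unfolding conjugate_def by blast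
  fix x assume "x \<in> conjugate g A"
  then obtain a where a: "a \<in> A" "x = g \<otimes> a \<otimes> inv g"
    by (auto simp: conjugate_def)
  then have "inv x = g \<otimes> inv a \<otimes> inv g"
    using assms(1) by (simp add: inv_mult_group m_assoc)
  then show "inv x \<in> conjugate g A"
    using a by (auto simp: conjugate_def)
  fix y assume "y \<in> conjugate g A"
  then obtain b where b: "b \<in> A" "y = g \<otimes> b \<otimes> inv g"
    by (auto simp: conjugate_def)
  have "inv g \<otimes> (g \<otimes> (b \<otimes> inv g)) = b \<otimes> inv g"
    using assms(1) b(1) by (simp flip: m_assoc)
  then have "x \<otimes> y = g \<otimes> (a \<otimes> b) \<otimes> inv g"
    unfolding a b using assms(1) a(1) b(1) by (simp add: m_assoc)
  then show "x \<otimes> y \<in> conjugate g A"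
    using a(1) b(1) by (auto simp: conjugate_def)
qed

text \<open>By Sylow conjugacy inside \<open>N\<close>, the conjugates of \<open>S\<close> under \<open>G\<close> are already conjugate under \<open>N\<close>. Their
number divides \<open>card N\<close> and so is prime to \<open>p\<close>. The stabilizer of \<open>S\<close> in \<open>G\<close> therefore has
order divisible by \<open>p\<close>, and Cauchy's theorem applies to it.\<close>

lemma (in group) frattini:
  assumes fin: "finite (carrier G)" and N: "N \<lhd> G" and S: "subgroup S G" "S \<subseteq> N"
    and card: "card S = q ^ a" "prime q" "\<not> q * card S dvd card N"
    and p: "prime p" "p dvd order G" "\<not> p dvd card N"
  shows "\<exists>x\<in>carrier G. ord x = p \<and> conjugate x S = S"
proof -
  interpret N: normal N G by fact
  interpret S: subgroup S G by fact
  let ?GN = "G\<lparr>carrier := N\<rparr>"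
  interpret GN: group ?GN by (rule subgroup_imp_group[OF N.subgroup_axioms])
  define \<Omega> where "\<Omega> = (\<lambda>n. conjugate n S) ` N"
  have sub: "A \<subseteq> carrier G" if "A \<in> \<Omega>" for A
    using that conjugate_closed[OF S.subset] N.subset by (auto simp: \<Omega>_def)
  have in\<Omega>: "conjugate g S \<in> \<Omega>" if g: "g \<in> carrier G" for g
  proof -
    have sg: "subgroup (conjugate g S) G"
      using g S(1) by (rule subgroup_conjugate)
    have cN: "conjugate g S \<subseteq> N"
      using g S(2) N.inv_op_closed2 by (auto simp: conjugate_def)
    have "\<exists>n\<in>carrier ?GN. \<forall>s\<in>conjugate g S. n \<otimes>\<^bsub>?GN\<^esub> s \<otimes>\<^bsub>?GN\<^esub> inv\<^bsub>?GN\<^esub> n \<in> S"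
    proof (rule GN.prime_power_subgroup_conjugate_into)
      show "finite (carrier ?GN)"
        using fin N.subset by (simp add: finite_subset)
      show "subgroup S ?GN" "subgroup (conjugate g S) ?GN"
        using S sg cN subgroup_incl N.subgroup_axioms by auto
      show "card (conjugate g S) = q ^ a"
        using card(1) g S.subset by (simp add: card_conjugate)
      show "\<not> q * card S dvd order ?GN"
        using card(3) by (simp add: order_def)
    qed fact
    then obtain n where n: "n \<in> N" "conjugate n (conjugate g S) \<subseteq> S"
      using m_inv_consistent[OF N.subgroup_axioms] by (auto simp: conjugate_def)
    have "card (conjugate n (conjugate g S)) = card S"
      using n(1) g S.subset by (simp add: card_conjugate conjugate_closed)
    then have "conjugate n (conjugate g S) = S"
      using n(2) fin S.subset by (intro card_subset_eq) (auto intro: finite_subset)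
    then have "conjugate g S = conjugate (inv n) S"
      using conjugate_inverse[of n "conjugate g S"] n(1) g S.subset by (simp add: conjugate_closed)
    then show ?thesis
      using n(1) by (auto simp: \<Omega>_def)
  qed
  have act: "group_action G \<Omega> (\<lambda>g. \<lambda>A\<in>\<Omega>. conjugate g A)"
  proof (rule group_actionI[OF is_group])
    fix g A assume *: "g \<in> carrier G" "A \<in> \<Omega>"
    then obtain n where n: "n \<in> N" "A = conjugate n S"
      by (auto simp: \<Omega>_def)
    then have "conjugate g A = conjugate (g \<otimes> n) S"
      using *(1) S.subset by (simp add: conjugate_mult)
    then show "conjugate g A \<in> \<Omega>"
      using in\<Omega>[of "g \<otimes> n"] *(1) n(1) by simp
  qed (use sub in \<open>auto simp: conjugate_one conjugate_mult\<close>)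
  have S\<Omega>: "S \<in> \<Omega>"
    using in\<Omega>[OF one_closed] S.subset by (simp add: conjugate_one)
  let ?\<phi> = "\<lambda>g. \<lambda>A\<in>\<Omega>. conjugate g A"
  interpret act: group_action G \<Omega> ?\<phi> by (rule act)
  interpret actN: group_action ?GN \<Omega> ?\<phi>
    by (rule act.induced_action[OF N.subgroup_axioms])
  have orb: "orbit ?GN ?\<phi> S = \<Omega>"
    using S\<Omega> unfolding orbit_def Setcompr_eq_image by (simp add: \<Omega>_def)
  have "orbit G ?\<phi> S = (\<lambda>g. conjugate g S) ` carrier G"
    using S\<Omega> unfolding orbit_def Setcompr_eq_image by simp
  also have "\<dots> = \<Omega>"
    using in\<Omega> N.subset unfolding \<Omega>_def by blast
  finally have "orbit G ?\<phi> S = \<Omega>" .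
  then have cG: "card \<Omega> * card (stabilizer G ?\<phi> S) = order G"
    using act.orbit_stabilizer_theorem[OF S\<Omega>] by simp
  have "card \<Omega> dvd card N"
    using actN.orbit_stabilizer_theorem[OF S\<Omega>] dvd_triv_left[of "card \<Omega>"] unfolding orb
    by (simp add: order_def) (metis dvd_triv_left)
  then have "\<not> p dvd card \<Omega>"
    using p(3) dvd_trans by blast
  then have "p dvd card (stabilizer G ?\<phi> S)"
    using p(1,2) cG prime_dvd_mult_iff by metis
  moreover have st: "subgroup (stabilizer G ?\<phi> S) G"
    by (rule act.stabilizer_subgroup[OF S\<Omega>])
  ultimately obtain x where x: "x \<in> stabilizer G ?\<phi> S" "group.ord (G\<lparr>carrier := stabilizer G ?\<phi> S\<rparr>) x = p"
    using group.cauchy[OF subgroup_imp_group[OF st], of p] p(1) finite_subset[OF subgroup.subset[OF st] fin]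
    by (auto simp: order_def)
  then have "ord x = p"
    using ord_subgroup[OF st] by simp
  moreover have "x \<in> carrier G" "conjugate x S = S"
    using x(1) S\<Omega> by (auto simp: stabilizer_def)
  ultimately show ?thesis by blast
qed

section \<open>Involutions acting on an abelian normal subgroup\<close>

lemma (in group) inv_cancel_left:
  assumes "x \<in> carrier G" "z \<in> carrier G"
  shows "x \<otimes> (inv x \<otimes> z) = z" "inv x \<otimes> (x \<otimes> z) = z"
  using assms by (simp_all flip: m_assoc)

definition (in group) centralizer :: "'a set \<Rightarrow> 'a set" where
  "centralizer E = {c \<in> carrier G. \<forall>e\<in>E. c \<otimes> e = e \<otimes> c}"

lemma (in normal) centralizer_normal: "centralizer H \<lhd> G"
proof (rule normal_invI)
  show "subgroup (centralizer H) G"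
  proof (rule subgroupI)
    show "centralizer H \<noteq> {}"
      by (auto simp: centralizer_def intro!: exI[of _ \<one>])
    fix a assume a: "a \<in> centralizer H"
    have "inv a \<otimes> e = e \<otimes> inv a" if "e \<in> H" for e
    proof -
      have ae: "a \<in> carrier G" "e \<in> carrier G" "a \<otimes> e = e \<otimes> a"
        using a that by (auto simp: centralizer_def)
      have "inv a \<otimes> e = inv a \<otimes> (e \<otimes> a) \<otimes> inv a"
        using ae(1,2) by (simp add: m_assoc)
      also have "\<dots> = (inv a \<otimes> a) \<otimes> e \<otimes> inv a"
        using ae(1,2) by (simp only: ae(3)[symmetric] m_assoc m_closed inv_closed)
      finally show ?thesis
        using ae(1,2) by simp
    qed
    then show "inv a \<in> centralizer H"
      using a by (auto simp: centralizer_def)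
    fix b assume b: "b \<in> centralizer H"
    have "a \<otimes> b \<otimes> e = e \<otimes> (a \<otimes> b)" if "e \<in> H" for e
    proof -
      have ab: "a \<in> carrier G" "b \<in> carrier G" "e \<in> carrier G" "a \<otimes> e = e \<otimes> a" "b \<otimes> e = e \<otimes> b"
        using a b that by (auto simp: centralizer_def)
      have "a \<otimes> b \<otimes> e = (a \<otimes> e) \<otimes> b"
        using ab(1-3) by (simp add: m_assoc ab(5))
      also have "\<dots> = e \<otimes> (a \<otimes> b)"
        using ab(1-3) by (simp add: m_assoc ab(4))
      finally show ?thesis .
    qed
    then show "a \<otimes> b \<in> centralizer H"
      using a b by (auto simp: centralizer_def)
  qed (auto simp: centralizer_def)
next
  fix x c assume x: "x \<in> carrier G" and c: "c \<in> centralizer H"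
  have "x \<otimes> c \<otimes> inv x \<otimes> e = e \<otimes> (x \<otimes> c \<otimes> inv x)" if e: "e \<in> H" for e
  proof -
    let ?e = "inv x \<otimes> e \<otimes> x"
    have cc: "c \<in> carrier G" "c \<otimes> ?e = ?e \<otimes> c"
      using c inv_op_closed1[OF x e] by (auto simp: centralizer_def)
    have "x \<otimes> c \<otimes> inv x \<otimes> e = x \<otimes> (c \<otimes> ?e) \<otimes> inv x"
      using x e cc(1) by (simp add: m_assoc)
    also have "\<dots> = x \<otimes> (?e \<otimes> c) \<otimes> inv x"
      by (simp add: cc(2))
    also have "\<dots> = e \<otimes> (x \<otimes> c \<otimes> inv x)"
      using x e cc(1) by (simp add: m_assoc inv_cancel_left)
    finally show ?thesis .
  qed
  then show "x \<otimes> c \<otimes> inv x \<in> centralizer H"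
    using x c by (auto simp: centralizer_def)
qed

lemma (in normal) exists_ord_of_dvd_centralizer:
  assumes "finite (carrier G)" "H \<noteq> {\<one>}" "\<And>e. e \<in> H \<Longrightarrow> e [^] q = \<one>" "prime q"
    and "prime r" "r \<noteq> q" "r dvd card (centralizer H)"
  shows "\<exists>x\<in>carrier G. ord x = r * q"
proof -
  interpret C: normal "centralizer H" G by (rule centralizer_normal)
  obtain c where c: "c \<in> centralizer H" "ord c = r"
    using group.cauchy[OF subgroup_imp_group[OF C.subgroup_axioms], of r] assms(1,5,7)
      finite_subset[OF C.subset] ord_subgroup[OF C.subgroup_axioms] by (auto simp: order_def)
  obtain e where e: "e \<in> H" "e \<noteq> \<one>"
    using assms(2) one_closed by auto
  have "ord e = q"
    by (rule ord_eq_primeI[OF mem_carrier[OF e(1)] e(2) assms(3)[OF e(1)] assms(4)])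
  moreover have "c \<otimes> e = e \<otimes> c"
    using c(1) e(1) unfolding centralizer_def by blast
  ultimately show ?thesis
    using exists_ord_of_commuting[OF assms(1) C.mem_carrier[OF c(1)] mem_carrier[OF e(1)] _ assms(5,4,6)] c(2)
    by simp
qed

text \<open>Let \<open>t\<close> be an involution. For \<open>e\<close> in \<open>H\<close> the product of \<open>e\<close> and its conjugate by \<open>t\<close> commutes with \<open>t\<close>;
as no element has order \<open>2 * q\<close>, this product is trivial, so \<open>t\<close> inverts \<open>H\<close>. Inversion commutes with
conjugation by \<open>y\<close>, so \<open>t\<close> and \<open>y\<close> commute modulo the centralizer of \<open>H\<close>.\<close>

lemma (in normal) exists_ord_of_involution_inverting:
  assumes fin: "finite (carrier G)" and ne: "H \<noteq> {\<one>}"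
    and comm: "\<And>a b. a \<in> H \<Longrightarrow> b \<in> H \<Longrightarrow> a \<otimes> b = b \<otimes> a"
    and expo: "\<And>e. e \<in> H \<Longrightarrow> e [^] q = \<one>" and q: "prime q" "q \<noteq> 2"
    and even: "2 dvd order G" and no: "\<And>x. x \<in> carrier G \<Longrightarrow> ord x \<noteq> 2 * q"
    and s: "prime s" "s \<noteq> 2"
    and y: "y \<in> carrier G" "y \<notin> centralizer H" "y [^] s \<in> centralizer H"
  shows "\<exists>x\<in>carrier G. ord x = 2 * s"
proof -
  interpret C: normal "centralizer H" G by (rule centralizer_normal)
  obtain t where t: "t \<in> carrier G" "ord t = 2"
    using cauchy[OF fin two_is_prime_nat even] by blast
  have tt: "t \<otimes> t = \<one>"
    using pow_ord_eq_1[OF t(1)] t by (simp add: numeral_2_eq_2)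
  then have inv_t: "inv t = t"
    using t(1) inv_equality by blast
  have nofix: "e = \<one>" if "e \<in> H" "t \<otimes> e = e \<otimes> t" for e
  proof (rule ccontr)
    assume "e \<noteq> \<one>"
    then have "ord e = q"
      by (intro ord_eq_primeI[OF mem_carrier[OF that(1)] _ expo[OF that(1)] q(1)])
    then show False
      using exists_ord_of_commuting[OF fin t(1) mem_carrier[OF that(1)] that(2) two_is_prime_nat q(1)] t(2) q(2) no
      by (metis dvd_refl)
  qed
  have inverts: "t \<otimes> e \<otimes> t = inv e" if e: "e \<in> H" for e
  proof -
    have u: "t \<otimes> e \<otimes> t \<in> H"
      using inv_op_closed2[OF t(1) e] by (simp add: inv_t)
    \<comment> \<open>Commutativity of \<open>H\<close> is used to exchange \<open>e\<close> with its conjugate.\<close>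
    have "t \<otimes> (t \<otimes> e \<otimes> t \<otimes> e) = (t \<otimes> t) \<otimes> e \<otimes> t \<otimes> e"
      using t(1) e by (simp add: m_assoc)
    also have "\<dots> = e \<otimes> t \<otimes> e \<otimes> (t \<otimes> t)"
      using t(1) e by (simp add: tt)
    also have "\<dots> = (e \<otimes> (t \<otimes> e \<otimes> t)) \<otimes> t"
      using t(1) e by (simp add: m_assoc)
    also have "e \<otimes> (t \<otimes> e \<otimes> t) = t \<otimes> e \<otimes> t \<otimes> e"
      using comm[OF e u] .
    finally have "t \<otimes> e \<otimes> t \<otimes> e = \<one>"
      using nofix u e by blast
    then show ?thesis
      using t(1) e by (intro inv_equality[symmetric]) auto
  qed
  obtain e0 where e0: "e0 \<in> H" "e0 \<noteq> \<one>"
    using ne one_closed by auto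
  have tC: "t \<notin> centralizer H"
    using nofix[OF e0(1)] e0 unfolding centralizer_def by blast
  have "t \<otimes> y \<otimes> inv t \<otimes> inv y \<in> centralizer H"
    unfolding centralizer_def
  proof (intro CollectI conjI ballI)
    fix e assume e: "e \<in> H"
    let ?f = "inv y \<otimes> e \<otimes> y"
    have f: "?f \<in> H" using inv_op_closed1[OF y(1) e] .
    have "y \<otimes> inv ?f \<otimes> inv y = inv e"
      using y(1) e by (simp add: inv_mult_group m_assoc inv_cancel_left)
    then have conj: "t \<otimes> (y \<otimes> (t \<otimes> ?f \<otimes> t) \<otimes> inv y) \<otimes> t = e"
      using inverts[OF f] inverts[of "inv e"] e by simp
    let ?c = "t \<otimes> y \<otimes> t \<otimes> inv y"
    have "?c \<otimes> e \<otimes> inv ?c = t \<otimes> (y \<otimes> (t \<otimes> ?f \<otimes> t) \<otimes> inv y) \<otimes> t"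
      using t(1) y(1) e by (simp add: inv_mult_group inv_t m_assoc)
    then have "?c \<otimes> e = e \<otimes> ?c"
      using conj inv_solve_right[of e "?c \<otimes> e" ?c] t(1) y(1) e by auto
    then show "t \<otimes> y \<otimes> inv t \<otimes> inv y \<otimes> e = e \<otimes> (t \<otimes> y \<otimes> inv t \<otimes> inv y)"
      by (simp add: inv_t)
  qed (use t(1) y(1) in auto)
  moreover have "t [^] (2::nat) \<in> centralizer H"
    using t(1) C.one_closed by (simp add: numeral_2_eq_2 tt)
  ultimately show ?thesis
    using C.exists_ord_of_commuting_cosets[OF fin t(1) y(1) _ tC y(2) _ y(3) two_is_prime_nat s(1)] s(2) by simp
qed

section \<open>Frobenius groups acting on abelian groups\<close>

lemma (in comm_group) finprod_hom:
  assumes "\<phi> \<in> hom G G" "f \<in> A \<rightarrow> carrier G"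
  shows "\<phi> (finprod G f A) = finprod G (\<lambda>x. \<phi> (f x)) A"
  using assms(2)
proof (induction A rule: infinite_finite_induct)
  case (insert a A)
  then show ?case
    using hom_mult[OF assms(1)] hom_in_carrier[OF assms(1)] by (simp add: Pi_iff)
qed (use hom_one[OF assms(1) is_group is_group] in auto)

lemma (in comm_group) finprod_swap:
  assumes "\<And>a b. a \<in> A \<Longrightarrow> b \<in> B \<Longrightarrow> f a b \<in> carrier G" "finite A"
  shows "finprod G (\<lambda>a. finprod G (\<lambda>b. f a b) B) A = finprod G (\<lambda>b. finprod G (\<lambda>a. f a b) A) B"
  using assms(2,1)
proof (induction A rule: finite_induct)
  case (insert a A)
  have "finprod G (\<lambda>b. finprod G (\<lambda>a. f a b) (insert a A)) B
      = finprod G (\<lambda>b. f a b \<otimes> finprod G (\<lambda>a. f a b) A) B"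
    using insert by (intro finprod_cong') (auto simp: Pi_iff)
  then show ?case
    using insert by (simp add: Pi_iff)
qed simp

locale action_on_abelian = H: comm_group H + G: group G for H (structure) and G +
  fixes act
  assumes act_hom: "g \<in> carrier G \<Longrightarrow> act g \<in> hom H H"
    and act_mult: "g \<in> carrier G \<Longrightarrow> h \<in> carrier G \<Longrightarrow> e \<in> carrier H \<Longrightarrow> act (g \<otimes>\<^bsub>G\<^esub> h) e = act g (act h e)"
    and act_one: "e \<in> carrier H \<Longrightarrow> act \<one>\<^bsub>G\<^esub> e = e"
begin

lemma act_closed: "g \<in> carrier G \<Longrightarrow> e \<in> carrier H \<Longrightarrow> act g e \<in> carrier H"
  using act_hom hom_in_carrier by metis

text \<open>The norm of \<open>e\<close> over \<open>K\<close> is fixed by each element of \<open>K\<close>, in particular by the fixed point free element \<open>k\<close>.\<close>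

lemma norm_eq_one:
  assumes K: "subgroup K G" "k \<in> K" and fpf: "\<And>e. e \<in> carrier H \<Longrightarrow> act k e = e \<Longrightarrow> e = \<one>"
    and e: "e \<in> carrier H"
  shows "finprod H (\<lambda>x. act x e) K = \<one>"
proof -
  interpret K: subgroup K G by fact
  have clo: "(\<lambda>x. act x e) \<in> K \<rightarrow> carrier H"
    using e act_closed by auto
  have img: "(\<lambda>x. k \<otimes>\<^bsub>G\<^esub> x) ` K = K"
  proof
    show "K \<subseteq> (\<lambda>x. k \<otimes>\<^bsub>G\<^esub> x) ` K"
    proof
      fix x assume "x \<in> K"
      then have "x = k \<otimes>\<^bsub>G\<^esub> (inv\<^bsub>G\<^esub> k \<otimes>\<^bsub>G\<^esub> x)" "inv\<^bsub>G\<^esub> k \<otimes>\<^bsub>G\<^esub> x \<in> K"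
        using K(2) by (auto simp flip: G.m_assoc)
      then show "x \<in> (\<lambda>x. k \<otimes>\<^bsub>G\<^esub> x) ` K" by blast
    qed
  qed (use K(2) in auto)
  have inj: "inj_on (\<lambda>x. k \<otimes>\<^bsub>G\<^esub> x) K"
    using K(2) by (auto intro!: inj_onI)
  have "act k (finprod H (\<lambda>x. act x e) K) = finprod H (\<lambda>x. act k (act x e)) K"
    using act_hom K(2) clo by (intro H.finprod_hom) auto
  also have "\<dots> = finprod H (\<lambda>x. act (k \<otimes>\<^bsub>G\<^esub> x) e) K"
    using K(2) e by (intro H.finprod_cong') (auto simp: act_mult act_closed)
  also have "\<dots> = finprod H (\<lambda>x. act x e) ((\<lambda>x. k \<otimes>\<^bsub>G\<^esub> x) ` K)"
    using clo inj by (subst H.finprod_reindex) (auto simp: img)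
  also have "\<dots> = finprod H (\<lambda>x. act x e) K"
    by (simp add: img)
  finally show ?thesis
    using fpf clo by simp
qed

text \<open>The product over all \<open>u\<close> in \<open>Q\<close> and \<open>x\<close> in \<open>Y\<close> of the images of \<open>e\<close> under the conjugates \<open>u x u\<inverse>\<close> is
computed in two ways. For fixed \<open>u\<close> it is, up to applying \<open>u\<close>, a norm over \<open>Y\<close> and hence trivial.
For fixed \<open>x \<noteq> 1\<close> the elements \<open>u x u\<inverse> x\<inverse>\<close> run through \<open>Q\<close>, because \<open>x\<close> commutes with no nontrivial
element of \<open>Q\<close>; this gives a norm over \<open>Q\<close>, which is trivial too. Only \<open>x = 1\<close> remains, and it
contributes \<open>e [^] card Q\<close>.\<close>

lemma frobenius_action_exponent:
  assumes Q: "subgroup Q G" "finite Q" and Y: "subgroup Y G" "finite Y"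
    and norm: "\<And>x u. x \<in> Y \<Longrightarrow> u \<in> Q \<Longrightarrow> x \<otimes>\<^bsub>G\<^esub> u \<otimes>\<^bsub>G\<^esub> inv\<^bsub>G\<^esub> x \<in> Q"
    and fpf: "\<And>x u. x \<in> Y \<Longrightarrow> x \<noteq> \<one>\<^bsub>G\<^esub> \<Longrightarrow> u \<in> Q \<Longrightarrow> x \<otimes>\<^bsub>G\<^esub> u = u \<otimes>\<^bsub>G\<^esub> x \<Longrightarrow> u = \<one>\<^bsub>G\<^esub>"
    and u0: "u0 \<in> Q" "\<And>e. e \<in> carrier H \<Longrightarrow> act u0 e = e \<Longrightarrow> e = \<one>"
    and x0: "x0 \<in> Y" "\<And>e. e \<in> carrier H \<Longrightarrow> act x0 e = e \<Longrightarrow> e = \<one>"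
    and e: "e \<in> carrier H"
  shows "e [^] card Q = \<one>"
proof -
  interpret Q: subgroup Q G by fact
  interpret Y: subgroup Y G by fact
  define f where "f u x = act (u \<otimes>\<^bsub>G\<^esub> x \<otimes>\<^bsub>G\<^esub> inv\<^bsub>G\<^esub> u) e" for u x
  have clo: "f u x \<in> carrier H" if "u \<in> Q" "x \<in> Y" for u x
    using that e by (auto simp: f_def intro!: act_closed)
  have inner1: "finprod H (\<lambda>x. f u x) Y = \<one>" if u: "u \<in> Q" for u
  proof -
    let ?e = "act (inv\<^bsub>G\<^esub> u) e"
    have e': "?e \<in> carrier H" using u e by (auto intro!: act_closed)
    have "finprod H (\<lambda>x. f u x) Y = finprod H (\<lambda>x. act u (act x ?e)) Y"
      using u e by (intro H.finprod_cong') (auto simp: f_def act_mult act_closed)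
    also have "\<dots> = act u (finprod H (\<lambda>x. act x ?e) Y)"
      using u e' act_hom by (intro H.finprod_hom[symmetric]) (auto simp: act_closed)
    also have "finprod H (\<lambda>x. act x ?e) Y = \<one>"
      using Y(1) x0 e' by (rule norm_eq_one)
    also have "act u \<one> = \<one>"
      using u act_hom hom_one[OF _ H.is_group H.is_group] by auto
    finally show ?thesis .
  qed
  have inner2: "finprod H (\<lambda>u. f u x) Q = \<one>" if x: "x \<in> Y" "x \<noteq> \<one>\<^bsub>G\<^esub>" for x
  proof -
    let ?h = "\<lambda>u. u \<otimes>\<^bsub>G\<^esub> (x \<otimes>\<^bsub>G\<^esub> inv\<^bsub>G\<^esub> u \<otimes>\<^bsub>G\<^esub> inv\<^bsub>G\<^esub> x)"
    let ?e = "act x e"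
    have e': "?e \<in> carrier H" using x e by (auto intro!: act_closed)
    \<comment> \<open>If \<open>u\<close> and \<open>v\<close> have the same image, then \<open>v\<inverse> u\<close> commutes with \<open>x\<close>.\<close>
    have inj: "inj_on ?h Q"
    proof (rule inj_onI)
      fix u v assume uv: "u \<in> Q" "v \<in> Q" "?h u = ?h v"
      let ?w = "inv\<^bsub>G\<^esub> v \<otimes>\<^bsub>G\<^esub> u"
      have car: "u \<in> carrier G" "v \<in> carrier G" "x \<in> carrier G" using uv x by auto
      have "?h u \<otimes>\<^bsub>G\<^esub> x = u \<otimes>\<^bsub>G\<^esub> x \<otimes>\<^bsub>G\<^esub> inv\<^bsub>G\<^esub> u" "?h v \<otimes>\<^bsub>G\<^esub> x = v \<otimes>\<^bsub>G\<^esub> x \<otimes>\<^bsub>G\<^esub> inv\<^bsub>G\<^esub> v"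
        using car by (simp_all add: G.m_assoc)
      then have "u \<otimes>\<^bsub>G\<^esub> x \<otimes>\<^bsub>G\<^esub> inv\<^bsub>G\<^esub> u = v \<otimes>\<^bsub>G\<^esub> x \<otimes>\<^bsub>G\<^esub> inv\<^bsub>G\<^esub> v"
        using uv(3) by simp
      then have "inv\<^bsub>G\<^esub> v \<otimes>\<^bsub>G\<^esub> (u \<otimes>\<^bsub>G\<^esub> x \<otimes>\<^bsub>G\<^esub> inv\<^bsub>G\<^esub> u) \<otimes>\<^bsub>G\<^esub> u = inv\<^bsub>G\<^esub> v \<otimes>\<^bsub>G\<^esub> (v \<otimes>\<^bsub>G\<^esub> x \<otimes>\<^bsub>G\<^esub> inv\<^bsub>G\<^esub> v) \<otimes>\<^bsub>G\<^esub> u"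
        by simp
      moreover have "inv\<^bsub>G\<^esub> v \<otimes>\<^bsub>G\<^esub> (u \<otimes>\<^bsub>G\<^esub> x \<otimes>\<^bsub>G\<^esub> inv\<^bsub>G\<^esub> u) \<otimes>\<^bsub>G\<^esub> u = ?w \<otimes>\<^bsub>G\<^esub> x"
        using car by (simp add: G.m_assoc)
      moreover have "inv\<^bsub>G\<^esub> v \<otimes>\<^bsub>G\<^esub> (v \<otimes>\<^bsub>G\<^esub> x \<otimes>\<^bsub>G\<^esub> inv\<^bsub>G\<^esub> v) \<otimes>\<^bsub>G\<^esub> u = (inv\<^bsub>G\<^esub> v \<otimes>\<^bsub>G\<^esub> v) \<otimes>\<^bsub>G\<^esub> x \<otimes>\<^bsub>G\<^esub> ?w"
        using car by (simp only: G.m_assoc G.m_closed G.inv_closed)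
      ultimately have "x \<otimes>\<^bsub>G\<^esub> ?w = ?w \<otimes>\<^bsub>G\<^esub> x"
        using car by simp
      then have "?w = \<one>\<^bsub>G\<^esub>"
        using fpf[OF x] uv by simp
      then show "u = v"
        using car G.inv_solve_left[of "\<one>\<^bsub>G\<^esub>" v u] by simp
    qed
    have sub: "?h ` Q \<subseteq> Q"
      using norm x by auto
    then have img: "?h ` Q = Q"
      using inj Q(2) by (simp add: card_subset_eq card_image)
    have "finprod H (\<lambda>u. f u x) Q = finprod H (\<lambda>u. act (?h u) ?e) Q"
    proof (rule H.finprod_cong'[OF refl])
      fix u assume u: "u \<in> Q"
      have "u \<otimes>\<^bsub>G\<^esub> x \<otimes>\<^bsub>G\<^esub> inv\<^bsub>G\<^esub> u = ?h u \<otimes>\<^bsub>G\<^esub> x"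
        using u x by (simp add: G.m_assoc)
      moreover have "?h u \<in> carrier G"
        using u x by simp
      ultimately show "f u x = act (?h u) ?e"
        using act_mult[of "?h u" x e] x e by (simp add: f_def)
    qed (use e' sub x in \<open>auto intro!: act_closed\<close>)
    also have "\<dots> = finprod H (\<lambda>u. act u ?e) (?h ` Q)"
      using inj e' by (subst H.finprod_reindex) (auto simp: img intro!: act_closed)
    also have "\<dots> = \<one>"
      unfolding img using Q(1) u0 e' by (rule norm_eq_one)
    finally show ?thesis .
  qed
  have "\<one> = finprod H (\<lambda>u. finprod H (\<lambda>x. f u x) Y) Q"
    by (rule H.finprod_one_eqI[symmetric]) (rule inner1)
  also have "\<dots> = finprod H (\<lambda>x. finprod H (\<lambda>u. f u x) Q) Y"
    using clo Q(2) by (rule H.finprod_swap)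
  also have "\<dots> = finprod H (\<lambda>x. if \<one>\<^bsub>G\<^esub> = x then finprod H (\<lambda>u. f u x) Q else \<one>) Y"
    using clo inner2 by (intro H.finprod_cong') auto
  also have "\<dots> = finprod H (\<lambda>u. f u \<one>\<^bsub>G\<^esub>) Q"
    using Y.one_closed Y(2) clo by (subst H.finprod_singleton) auto
  also have "\<dots> = finprod H (\<lambda>u. e) Q"
    using e by (intro H.finprod_cong') (auto simp: f_def act_one)
  also have "\<dots> = e [^] card Q"
    using e by (rule H.finprod_const)
  finally show ?thesis by simp
qed

end

section \<open>Normal subgroups of subgroups and of quotients\<close>

lemma (in group) normal_in_subgroup_iff:
  assumes "subgroup N G"
  shows "L \<lhd> G\<lparr>carrier := N\<rparr> \<longleftrightarrow>
    subgroup L G \<and> L \<subseteq> N \<and> (\<forall>n\<in>N. \<forall>l\<in>L. n \<otimes> l \<otimes> inv n \<in> L)"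
proof -
  interpret N: group "G\<lparr>carrier := N\<rparr>" by (rule subgroup_imp_group[OF assms])
  have "subgroup L (G\<lparr>carrier := N\<rparr>) \<longleftrightarrow> subgroup L G \<and> L \<subseteq> N"
    using incl_subgroup[OF assms] subgroup_incl[OF _ assms] subgroup.subset[of L "G\<lparr>carrier := N\<rparr>"] by auto
  then show ?thesis
    unfolding N.normal_inv_iff using m_inv_consistent[OF assms] by auto
qed

lemma (in normal) card_Union_rcosets:
  assumes "finite (carrier G)" "A \<subseteq> carrier (G Mod H)"
  shows "card (\<Union>A) = card A * card H"
proof -
  have sub: "A \<subseteq> rcosets H"
    using assms(2) by (simp add: FactGroup_def)
  have fin: "finite (\<Union>A)"
    using sub rcosets_part_G[OF subgroup_axioms] assms(1) by (auto intro: finite_subset)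
  have "card H * card A = card (\<Union>A)"
  proof (rule card_partition)
    show "finite A" using fin by (rule finite_UnionD)
    show "card c = card H" if "c \<in> A" for c
      using card_rcosets_equal[OF _ subset] that sub by (metis subsetD)
    show "c1 \<inter> c2 = {}" if "c1 \<in> A" "c2 \<in> A" "c1 \<noteq> c2" for c1 c2
      using rcos_disjoint[OF subgroup_axioms] that sub by (auto simp: pairwise_def disjnt_def)
  qed (rule fin)
  then show ?thesis by (simp add: mult.commute)
qed

lemma (in normal) prime_times_card_dvd_order:
  assumes "prime p" "p dvd order G" "\<not> p dvd card H"
  shows "p * card H dvd order G"
proof (rule divides_mult)
  show "card H dvd order G"
    using order_quotient by (metis dvd_triv_right)
  show "coprime p (card H)"
    using assms(1,3) by (simp add: prime_imp_coprime_nat)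
qed (rule assms(2))

lemma (in normal) image_Union_rcosets:
  assumes "subgroup A (G Mod H)"
  shows "(\<lambda>x. H #> x) ` (\<Union>A) = A"
  using factgroup_subgroup_union_char[OF assms] subgroup.subset[OF assms] by (auto simp: carrier_FactGroup)

lemma (in normal) subset_Union_rcosets:
  assumes "subgroup A (G Mod H)"
  shows "H \<subseteq> \<Union>A"
  using subgroup.one_closed[OF assms] by auto

lemma (in normal) coset_hom: "group_hom G (G Mod H) (\<lambda>x. H #> x)"
  by (simp add: group_hom_def group_hom_axioms_def is_group factorgroup_is_group r_coset_hom_Mod)

text \<open>The quotient \<open>N / L\<close> is then a simple group, a simple head of \<open>N\<close>.\<close>

definition maximal_normal :: "('a, 'b) monoid_scheme \<Rightarrow> 'a set \<Rightarrow> 'a set \<Rightarrow> bool" where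
  "maximal_normal G L N \<longleftrightarrow> L \<lhd> G\<lparr>carrier := N\<rparr> \<and> L \<noteq> N \<and>
     (\<forall>M. M \<lhd> G\<lparr>carrier := N\<rparr> \<longrightarrow> L \<subseteq> M \<longrightarrow> M = L \<or> M = N)"

text \<open>The trace of pseudo-solvability on which the whole argument rests: 60 is the order of the
alternating group of degree 5, and the primes are the orders of the cyclic simple groups. Only
subgroups \<open>N\<close> that are normal in \<open>G\<close> are considered, which makes the property stable under quotients and
suffices because all subgroups examined below are of this kind.\<close>

definition prime_or_60_heads :: "('a, 'b) monoid_scheme \<Rightarrow> bool" where
  "prime_or_60_heads G \<longleftrightarrow>
     (\<forall>N L. N \<lhd> G \<longrightarrow> maximal_normal G L N \<longrightarrow> (\<exists>k. card N = k * card L \<and> (prime k \<or> k = 60)))"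

lemma (in group) exists_maximal_normal:
  assumes "subgroup N G" "finite N" "B \<lhd> G\<lparr>carrier := N\<rparr>" "B \<noteq> N"
  shows "\<exists>L. maximal_normal G L N \<and> B \<subseteq> L"
proof -
  define F where "F = {L. L \<lhd> G\<lparr>carrier := N\<rparr> \<and> L \<noteq> N \<and> B \<subseteq> L}"
  have "F \<subseteq> Pow N"
    using normal_in_subgroup_iff[OF assms(1)] by (auto simp: F_def)
  then have "finite F"
    using assms(2) by (auto intro: finite_subset)
  moreover have "B \<in> F"
    using assms(3,4) by (simp add: F_def)
  ultimately obtain L where L: "L \<in> F" "\<And>M. M \<in> F \<Longrightarrow> L \<subseteq> M \<Longrightarrow> M = L"
    using finite_has_maximal2[of F B] by metis
  then show ?thesis
    unfolding maximal_normal_def F_def by blast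
qed

text \<open>Taking unions of cosets identifies the pairs \<open>L\<close>, \<open>N\<close> in the quotient with pairs in \<open>G\<close> lying above \<open>H\<close>;
it preserves normality and maximality, and multiplies both cardinalities by \<open>card H\<close>.\<close>

lemma (in normal) prime_or_60_heads_quotient:
  assumes fin: "finite (carrier G)" and heads: "prime_or_60_heads G"
  shows "prime_or_60_heads (G Mod H)"
  unfolding prime_or_60_heads_def
proof (intro allI impI)
  let ?Q = "G Mod H"
  interpret Q: group ?Q by (rule factorgroup_is_group)
  interpret \<pi>: group_hom G ?Q "\<lambda>x. H #> x" by (rule coset_hom)
  fix N L assume N: "N \<lhd> ?Q" and max: "maximal_normal ?Q L N"
  have sN: "subgroup N ?Q" using N by (rule normal_imp_subgroup)
  have L: "subgroup L ?Q" "L \<subseteq> N" "\<And>n l. n \<in> N \<Longrightarrow> l \<in> L \<Longrightarrow> n \<otimes>\<^bsub>?Q\<^esub> l \<otimes>\<^bsub>?Q\<^esub> inv\<^bsub>?Q\<^esub> n \<in> L"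
    using max Q.normal_in_subgroup_iff[OF sN] by (auto simp: maximal_normal_def)
  have N': "\<Union>N \<lhd> G" "subgroup (\<Union>N) G"
    using factgroup_subgroup_union_normal[OF N] normal_imp_subgroup by auto
  have "maximal_normal G (\<Union>L) (\<Union>N)"
    unfolding maximal_normal_def
  proof (intro conjI allI impI)
    show "\<Union>L \<lhd> G\<lparr>carrier := \<Union>N\<rparr>"
      unfolding normal_in_subgroup_iff[OF N'(2)]
    proof (intro conjI ballI)
      show "subgroup (\<Union>L) G"
        by (rule factgroup_subgroup_union_subgroup[OF L(1)])
      show "\<Union>L \<subseteq> \<Union>N" using L(2) by blast
      fix n l assume nl: "n \<in> \<Union>N" "l \<in> \<Union>L"
      then have *: "n \<in> carrier G" "H #> n \<in> N" "l \<in> carrier G" "H #> l \<in> L"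
        using factgroup_subgroup_union_char[OF sN] factgroup_subgroup_union_char[OF L(1)] by auto
      have "H #> (n \<otimes> l \<otimes> inv n) = (H #> n) \<otimes>\<^bsub>?Q\<^esub> (H #> l) \<otimes>\<^bsub>?Q\<^esub> inv\<^bsub>?Q\<^esub> (H #> n)"
        using *(1,3) by (simp del: mult_FactGroup)
      then have "H #> (n \<otimes> l \<otimes> inv n) \<in> L"
        using L(3)[OF *(2,4)] by simp
      then show "n \<otimes> l \<otimes> inv n \<in> \<Union>L"
        using *(1,3) factgroup_subgroup_union_char[OF L(1)] by simp
    qed
    show "\<Union>L \<noteq> \<Union>N"
    proof
      assume "\<Union>L = \<Union>N"
      then have "L = N"
        using image_Union_rcosets[OF L(1)] image_Union_rcosets[OF sN] by metis
      then show False
        using max by (simp add: maximal_normal_def)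
    qed
    fix M assume M: "M \<lhd> G\<lparr>carrier := \<Union>N\<rparr>" "\<Union>L \<subseteq> M"
    then have M': "subgroup M G" "M \<subseteq> \<Union>N" "\<And>n l. n \<in> \<Union>N \<Longrightarrow> l \<in> M \<Longrightarrow> n \<otimes> l \<otimes> inv n \<in> M"
      using normal_in_subgroup_iff[OF N'(2)] by auto
    let ?M = "(\<lambda>x. H #> x) ` M"
    have sM: "subgroup ?M ?Q"
      by (rule \<pi>.subgroup_img_is_subgroup[OF M'(1)])
    have "?M \<lhd> ?Q\<lparr>carrier := N\<rparr>"
      unfolding Q.normal_in_subgroup_iff[OF sN]
    proof (intro conjI ballI)
      show "?M \<subseteq> N"
        using image_mono[OF M'(2), of "\<lambda>x. H #> x"] unfolding image_Union_rcosets[OF sN] .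
      fix n l assume "n \<in> N" "l \<in> ?M"
      then have "n \<in> (\<lambda>x. H #> x) ` (\<Union>N)" "l \<in> ?M"
        unfolding image_Union_rcosets[OF sN] by simp_all
      then obtain n' l' where *: "n' \<in> \<Union>N" "n = H #> n'" "l' \<in> M" "l = H #> l'"
        by (elim imageE)
      have "n' \<in> carrier G" "l' \<in> carrier G"
        using *(1,3) subgroup.subset[OF M'(1)] subgroup.subset[OF N'(2)] by auto
      then have "n \<otimes>\<^bsub>?Q\<^esub> l \<otimes>\<^bsub>?Q\<^esub> inv\<^bsub>?Q\<^esub> n = H #> (n' \<otimes> l' \<otimes> inv n')"
        unfolding * by (simp del: mult_FactGroup)
      then show "n \<otimes>\<^bsub>?Q\<^esub> l \<otimes>\<^bsub>?Q\<^esub> inv\<^bsub>?Q\<^esub> n \<in> ?M"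
        using M'(3)[OF *(1,3)] by blast
    qed (rule sM)
    moreover have "L \<subseteq> ?M"
      using image_mono[OF M(2), of "\<lambda>x. H #> x"] unfolding image_Union_rcosets[OF L(1)] .
    ultimately have "?M = L \<or> ?M = N"
      using max by (simp add: maximal_normal_def)
    moreover have "\<Union>?M = M"
    proof
      have "H \<subseteq> M"
        using subset_Union_rcosets[OF L(1)] M(2) by blast
      then show "\<Union>?M \<subseteq> M"
        using subgroup.m_closed[OF M'(1)] by (auto simp: r_coset_def)
      show "M \<subseteq> \<Union>?M"
        using rcos_self[OF _ subgroup_axioms] subgroup.subset[OF M'(1)] by blast
    qed
    ultimately show "M = \<Union>L \<or> M = \<Union>N" by auto
  qed
  then obtain k where k: "card (\<Union>N) = k * card (\<Union>L)" "prime k \<or> k = 60"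
    using heads N'(1) unfolding prime_or_60_heads_def by blast
  moreover have "card (\<Union>N) = card N * card H" "card (\<Union>L) = card L * card H"
    using card_Union_rcosets[OF fin] subgroup.subset[OF sN] subgroup.subset[OF L(1)] by auto
  moreover have "card H \<noteq> 0"
    using finite_imp_card_positive[OF fin] by simp
  ultimately show "\<exists>k. card N = k * card L \<and> (prime k \<or> k = 60)"
    by auto
qed

section \<open>Derived subgroups and torsion\<close>

lemma (in group) commute_if_derived_trivial:
  assumes "derived G A \<subseteq> {\<one>}" "a \<in> A" "b \<in> A" "A \<subseteq> carrier G"
  shows "a \<otimes> b = b \<otimes> a"
proof -
  have "a \<otimes> b \<otimes> inv a \<otimes> inv b \<in> derived G A"
    unfolding derived_def using assms(2,3) by (blast intro: generate.incl)
  then have "(a \<otimes> b) \<otimes> inv (b \<otimes> a) = \<one>"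
    using assms by (auto simp: inv_mult_group m_assoc subset_iff)
  then show ?thesis
    using assms inv_solve_right[of \<one> "a \<otimes> b" "b \<otimes> a"] by (auto simp: subset_iff)
qed

lemma (in normal) commutator_closed_derived:
  "a \<in> H \<Longrightarrow> b \<in> H \<Longrightarrow> a \<otimes> b \<otimes> inv a \<otimes> inv b \<in> derived G H"
  unfolding derived_def by (blast intro: generate.incl)

definition torsion :: "('a, 'b) monoid_scheme \<Rightarrow> 'a set \<Rightarrow> nat \<Rightarrow> 'a set" where
  "torsion G A q = {a \<in> A. a [^]\<^bsub>G\<^esub> q = \<one>\<^bsub>G\<^esub>}"

lemma (in group) conjugate_pow:
  assumes "x \<in> carrier G" "y \<in> carrier G"
  shows "(x \<otimes> y \<otimes> inv x) [^] (n::nat) = x \<otimes> y [^] n \<otimes> inv x"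
  using assms by (induction n) (simp_all add: m_assoc inv_cancel_left)

lemma (in normal) torsion_normal:
  assumes comm: "\<And>a b. a \<in> H \<Longrightarrow> b \<in> H \<Longrightarrow> a \<otimes> b = b \<otimes> a"
  shows "torsion G H q \<lhd> G"
proof (rule normal_invI)
  show "subgroup (torsion G H q) G"
  proof (rule subgroupI)
    show "torsion G H q \<noteq> {}"
    proof -
      have "\<one> \<in> torsion G H q"
        by (simp add: torsion_def)
      then show ?thesis by blast
    qed
    show "inv a \<in> torsion G H q" if "a \<in> torsion G H q" for a
      using that by (simp add: torsion_def nat_pow_inv)
    show "a \<otimes> b \<in> torsion G H q" if "a \<in> torsion G H q" "b \<in> torsion G H q" for a b
    proof -
      have ab: "a \<in> H" "b \<in> H" "a [^] q = \<one>" "b [^] q = \<one>"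
        using that by (simp_all add: torsion_def)
      have "(a \<otimes> b) [^] q = a [^] q \<otimes> b [^] q"
        using ab(1,2) comm by (intro pow_mult_distrib) simp_all
      then show ?thesis
        using ab by (simp add: torsion_def)
    qed
    show "torsion G H q \<subseteq> carrier G"
      using subset by (auto simp: torsion_def)
  qed
  show "x \<otimes> h \<otimes> inv x \<in> torsion G H q" if "x \<in> carrier G" "h \<in> torsion G H q" for x h
    using that inv_op_closed2[of x h] by (simp add: torsion_def conjugate_pow)
qed

lemma (in normal) torsion_nontrivial:
  assumes "finite (carrier G)" "prime q" "q dvd card H"
  shows "torsion G H q \<noteq> {\<one>}"
proof -
  obtain x where x: "x \<in> H" "ord x = q"
    using group.cauchy[OF subgroup_imp_group[OF subgroup_axioms], of q] assms
      finite_subset[OF subset] ord_subgroup[OF subgroup_axioms] by (auto simp: order_def)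
  then have "x \<in> torsion G H q" "x \<noteq> \<one>"
    using pow_ord_eq_1[of x] assms(2) ord_eq_1[of x] by (auto simp: torsion_def)
  then show ?thesis by blast
qed

lemma (in normal) prime_dvd_card_torsion:
  assumes "finite (carrier G)" "torsion G H q \<lhd> G" "prime q" "prime r" "r dvd card (torsion G H q)"
  shows "r = q"
proof -
  interpret T: normal "torsion G H q" G by fact
  obtain x where x: "x \<in> torsion G H q" "ord x = r"
    using group.cauchy[OF subgroup_imp_group[OF T.subgroup_axioms], of r] assms
      finite_subset[OF T.subset] ord_subgroup[OF T.subgroup_axioms] by (auto simp: order_def)
  then have "r dvd q"
    using pow_eq_id[of x q] by (auto simp: torsion_def)
  then show ?thesis
    using assms(3,4) by (simp add: primes_dvd_imp_eq)
qed

lemma (in group) conjugate_generate: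
  assumes "finite (carrier G)" "x \<in> carrier G" "S \<subseteq> carrier G" "conjugate x S = S"
    and "z \<in> generate G {x}" "u \<in> S"
  shows "z \<otimes> u \<otimes> inv z \<in> S"
proof -
  obtain n :: nat where n: "z = x [^] n"
    using assms(5) generate_pow_on_finite_carrier[OF assms(1,2)] by auto
  have "conjugate (x [^] n) S = S"
    using assms(2,3) assms(4) by (induction n) (simp_all add: conjugate_one conjugate_mult)
  then show ?thesis
    using assms(6) unfolding n conjugate_def by blast
qed

lemma (in group) prime_dvd_ord_in_prime_power_subgroup:
  assumes "subgroup S G" "card S = q ^ a" "prime q" "u \<in> S" "u \<noteq> \<one>"
  shows "q dvd ord u"
proof -
  have "ord u dvd q ^ a"
    using group.ord_dvd_group_order[OF subgroup_imp_group[OF assms(1)], of u] assms(2,4)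
      ord_subgroup[OF assms(1,4)] by (simp add: order_def)
  then obtain i where "ord u = q ^ i"
    using assms(3) by (auto simp: divides_primepow_nat)
  moreover have "ord u \<noteq> 1"
    using ord_eq_1[of u] assms subgroup.mem_carrier[OF assms(1,4)] by simp
  ultimately show ?thesis
    by (cases i) auto
qed

section \<open>Solvable groups\<close>

text \<open>The cyclic group generated by \<open>x\<close> acts on \<open>S\<close>, and both act on \<open>H\<close> by conjugation. If none of the three
composite orders occurred, every action in sight would be fixed point free, and
\<open>frobenius_action_exponent\<close> would force the order \<open>s\<close> of a nontrivial element of \<open>H\<close> to divide a power of \<open>q\<close>.\<close>

lemma (in normal) frobenius_action_exists_ord:
  assumes fin: "finite (carrier G)" and ne: "H \<noteq> {\<one>}"
    and comm: "\<And>a b. a \<in> H \<Longrightarrow> b \<in> H \<Longrightarrow> a \<otimes> b = b \<otimes> a"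
    and expo: "\<And>e. e \<in> H \<Longrightarrow> e [^] s = \<one>" and s: "prime s"
    and S: "subgroup S G" "card S = q ^ a" "a > 0" "prime q"
    and x: "x \<in> carrier G" "ord x = p" "prime p" "conjugate x S = S"
    and distinct: "s \<noteq> q" "s \<noteq> p" "p \<noteq> q"
  shows "\<exists>g\<in>carrier G. ord g = q * s \<or> ord g = p * s \<or> ord g = p * q"
proof (rule ccontr)
  assume no: "\<not> ?thesis"
  let ?X = "generate G {x}"
  interpret S: subgroup S G by fact
  interpret GH: group "G\<lparr>carrier := H\<rparr>" by (rule subgroup_imp_group[OF subgroup_axioms])
  have cH: "comm_group (G\<lparr>carrier := H\<rparr>)"
    using comm by (intro GH.group_comm_groupI) simp
  have "action_on_abelian (G\<lparr>carrier := H\<rparr>) G (\<lambda>g e. g \<otimes> e \<otimes> inv g)"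
  proof (intro action_on_abelian.intro action_on_abelian_axioms.intro cH is_group)
    fix g assume g: "g \<in> carrier G"
    show "(\<lambda>e. g \<otimes> e \<otimes> inv g) \<in> hom (G\<lparr>carrier := H\<rparr>) (G\<lparr>carrier := H\<rparr>)"
    proof (rule homI)
      show "g \<otimes> e \<otimes> inv g \<in> carrier (G\<lparr>carrier := H\<rparr>)" if "e \<in> carrier (G\<lparr>carrier := H\<rparr>)" for e
        using that g inv_op_closed2[of g e] by simp
      show "g \<otimes> (e \<otimes>\<^bsub>G\<lparr>carrier := H\<rparr>\<^esub> f) \<otimes> inv g = (g \<otimes> e \<otimes> inv g) \<otimes>\<^bsub>G\<lparr>carrier := H\<rparr>\<^esub> (g \<otimes> f \<otimes> inv g)"
        if "e \<in> carrier (G\<lparr>carrier := H\<rparr>)" "f \<in> carrier (G\<lparr>carrier := H\<rparr>)" for e f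
        using that g by (simp add: m_assoc inv_cancel_left)
    qed
  next
    fix g h e assume "g \<in> carrier G" "h \<in> carrier G" "e \<in> carrier (G\<lparr>carrier := H\<rparr>)"
    then show "g \<otimes> h \<otimes> e \<otimes> inv (g \<otimes> h) = g \<otimes> (h \<otimes> e \<otimes> inv h) \<otimes> inv g"
      by (simp add: inv_mult_group m_assoc)
  next
    fix e assume "e \<in> carrier (G\<lparr>carrier := H\<rparr>)"
    then show "\<one> \<otimes> e \<otimes> inv \<one> = e" by simp
  qed
  then interpret act: action_on_abelian "G\<lparr>carrier := H\<rparr>" G "\<lambda>g e. g \<otimes> e \<otimes> inv g" .
  have sX: "subgroup ?X G"
    using x(1) by (intro generate_is_subgroup) simp
  have cX: "card ?X = p ^ 1"
    using generate_pow_card[OF x(1)] x(2) by simp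
  have fX: "finite ?X"
    using finite_subset[OF subgroup.subset[OF sX] fin] .
  have ord_e: "ord e = s" if "e \<in> H" "e \<noteq> \<one>" for e
    using ord_eq_primeI[OF mem_carrier[OF that(1)] that(2) expo[OF that(1)] s] .
  have fixed: "e = \<one>" if g: "g \<in> carrier G" "r dvd ord g" "prime r" "r \<noteq> s" "r = p \<or> r = q"
    and e: "e \<in> H" "g \<otimes> e \<otimes> inv g = e" for g r e
  proof (rule ccontr)
    assume "e \<noteq> \<one>"
    then have "ord e = s" using e(1) by (rule ord_e[rotated])
    moreover have "g \<otimes> e = e \<otimes> g"
      using e(2) inv_solve_right[of e "g \<otimes> e" g] g(1) mem_carrier[OF e(1)] by simp
    ultimately have "\<exists>y\<in>carrier G. ord y = r * s"
      using exists_ord_of_commuting[OF fin g(1) mem_carrier[OF e(1)] _ g(3) s g(4) g(2)] by simp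
    then show False using g(5) no by blast
  qed
  have "card S > 1"
    using one_less_power[OF prime_gt_1_nat[OF S(4)] S(3)] S(2) by simp
  then have "S \<noteq> {\<one>}" by auto
  then obtain u0 where u0: "u0 \<in> S" "u0 \<noteq> \<one>"
    using S.one_closed by auto
  obtain e0 where e0: "e0 \<in> H" "e0 \<noteq> \<one>"
    using ne one_closed by auto
  have "e0 [^]\<^bsub>G\<lparr>carrier := H\<rparr>\<^esub> card S = \<one>\<^bsub>G\<lparr>carrier := H\<rparr>\<^esub>"
  proof (rule act.frobenius_action_exponent[OF S(1) _ sX fX])
    show "finite S" using finite_subset[OF S.subset fin] .
    show "y \<otimes> u \<otimes> inv y \<in> S" if "y \<in> ?X" "u \<in> S" for y u
      using conjugate_generate[OF fin x(1) S.subset x(4) that] .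
    show "u = \<one>" if "y \<in> ?X" "y \<noteq> \<one>" "u \<in> S" "y \<otimes> u = u \<otimes> y" for y u
    proof (rule ccontr)
      assume "u \<noteq> \<one>"
      then have "q dvd ord u"
        using prime_dvd_ord_in_prime_power_subgroup[OF S(1,2,4) that(3)] by simp
      moreover have "p dvd ord y"
        using prime_dvd_ord_in_prime_power_subgroup[OF sX cX x(3) that(1,2)] .
      ultimately have "\<exists>g\<in>carrier G. ord g = p * q"
        using exists_ord_of_commuting[OF fin subgroup.mem_carrier[OF sX that(1)] S.mem_carrier[OF that(3)] that(4) x(3) S(4) distinct(3)]
        by simp
      then show False using no by blast
    qed
    show "u0 \<in> S" by fact
    show "e = \<one>\<^bsub>G\<lparr>carrier := H\<rparr>\<^esub>" if "e \<in> carrier (G\<lparr>carrier := H\<rparr>)" "u0 \<otimes> e \<otimes> inv u0 = e" for e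
      using fixed[of u0 q e] prime_dvd_ord_in_prime_power_subgroup[OF S(1,2,4) u0] u0(1) S(4) distinct(1) that
      by simp
    show "x \<in> ?X" by (simp add: generate.incl)
    show "e = \<one>\<^bsub>G\<lparr>carrier := H\<rparr>\<^esub>" if "e \<in> carrier (G\<lparr>carrier := H\<rparr>)" "x \<otimes> e \<otimes> inv x = e" for e
      using fixed[of x p e] x(1-3) distinct(2) that by simp
    show "e0 \<in> carrier (G\<lparr>carrier := H\<rparr>)" using e0(1) by simp
  qed
  then have "e0 [^] (q ^ a) = \<one>"
    using S(2) by (simp flip: nat_pow_consistent)
  then have "s dvd q ^ a"
    using pow_eq_id[OF mem_carrier[OF e0(1)], of "q ^ a"] ord_e[OF e0] by simp
  then have "s dvd q"
    using s prime_dvd_power by blast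
  then show False
    using s S(4) distinct(1) by (simp add: primes_dvd_imp_eq)
qed

lemma (in normal) sylow_normalizing_element:
  assumes fin: "finite (carrier G)" and q: "prime q" "q dvd card H"
    and p: "prime p" "p dvd order G" "\<not> p dvd card H"
  shows "\<exists>S x a. subgroup S G \<and> card S = q ^ a \<and> a > 0 \<and> x \<in> carrier G \<and> ord x = p \<and> conjugate x S = S"
proof -
  have fH: "finite H" using finite_subset[OF subset fin] .
  have "card H \<noteq> 0"
    using finite_imp_card_positive[OF fin] by simp
  then obtain a m where am: "card H = q ^ a * m" "\<not> q dvd m"
    using multiplicity_decompose'[of "card H" q] q(1) by (metis not_prime_unit)
  have "a > 0"
    using am q(2) by (cases a) auto
  obtain S where S: "subgroup S (G\<lparr>carrier := H\<rparr>)" "card S = q ^ a"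
    using sylow_thm[OF q(1) subgroup_imp_group[OF subgroup_axioms], of a m] fH am(1) by (auto simp: order_def)
  have sS: "subgroup S G" "S \<subseteq> H"
    using incl_subgroup[OF subgroup_axioms S(1)] subgroup.subset[OF S(1)] by auto
  have "\<not> q * card S dvd card H"
    using am q(1) S(2) by (simp add: mult.commute)
  then obtain x where "x \<in> carrier G" "ord x = p" "conjugate x S = S"
    using frattini[OF fin normal_axioms sS S(2) q(1) _ p] by blast
  then show ?thesis
    using sS(1) S(2) \<open>a > 0\<close> by blast
qed

lemma (in group) derived_power_normal: "(derived G ^^ n) (carrier G) \<lhd> G"
  by (induction n) (simp_all add: normal_self derived_is_normal)

text \<open>Follow the derived series down to the last term whose order is divisible by both primes. If the next
term has order divisible by one of them, the Frattini argument applied to this next term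
gives the required pair. If it has order divisible by neither, both primes divide the order of the abelian
quotient of the two terms, where elements of the two prime orders commute.\<close>

lemma (in group) solvable_sylow_normalizing_element:
  assumes fin: "finite (carrier G)" and solv: "solvable G"
    and q: "prime q" "q dvd order G" and p: "prime p" "p dvd order G" and "p \<noteq> q"
    and no: "\<And>g. g \<in> carrier G \<Longrightarrow> ord g \<noteq> p * q"
  shows "\<exists>S x a u v. (u = p \<and> v = q \<or> u = q \<and> v = p) \<and>
     subgroup S G \<and> card S = u ^ a \<and> a > 0 \<and> x \<in> carrier G \<and> ord x = v \<and> conjugate x S = S"
proof -
  define D where "D n = (derived G ^^ n) (carrier G)" for n
  have DN: "D n \<lhd> G" for n
    unfolding D_def by (rule derived_power_normal)
  obtain m where m: "D m = {\<one>}"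
    using solv by (auto simp: solvable_iff_trivial_derived_seq D_def)
  have "\<exists>n. p dvd card (D n) \<and> q dvd card (D n) \<and> \<not> (p dvd card (D (Suc n)) \<and> q dvd card (D (Suc n)))"
  proof (rule ccontr)
    assume *: "\<not> ?thesis"
    have "p dvd card (D n) \<and> q dvd card (D n)" for n
    proof (induction n)
      case 0 then show ?case using p q by (simp add: D_def order_def)
    next
      case (Suc n) then show ?case using * by blast
    qed
    from this[of m] show False
      using m p(1) by simp
  qed
  then obtain n where n: "p dvd card (D n)" "q dvd card (D n)"
    "\<not> (p dvd card (D (Suc n)) \<and> q dvd card (D (Suc n)))" by blast
  interpret K: normal "D (Suc n)" G by (rule DN)
  interpret N: normal "D n" G by (rule DN)
  have suc: "D (Suc n) = derived G (D n)" by (simp add: D_def)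
  consider "p dvd card (D (Suc n))" "\<not> q dvd card (D (Suc n))"
    | "q dvd card (D (Suc n))" "\<not> p dvd card (D (Suc n))"
    | "\<not> p dvd card (D (Suc n))" "\<not> q dvd card (D (Suc n))"
    using n(3) by blast
  then show ?thesis
  proof cases
    case 1
    from K.sylow_normalizing_element[OF fin p(1) 1(1) q 1(2)] show ?thesis by blast
  next
    case 2
    from K.sylow_normalizing_element[OF fin q(1) 2(1) p 2(2)] show ?thesis by blast
  next
    case 3
    let ?GN = "G\<lparr>carrier := D n\<rparr>"
    have KN: "D (Suc n) \<lhd> ?GN"
      unfolding suc by (rule derived_subgroup_is_normal[OF N.subgroup_axioms])
    then interpret KN: normal "D (Suc n)" ?GN .
    have finN: "finite (carrier ?GN)"
      using finite_subset[OF N.subset fin] by simp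
    have dvd: "r * card (D (Suc n)) dvd order ?GN" if "prime r" "r dvd card (D n)" "\<not> r dvd card (D (Suc n))" for r
      using KN.prime_times_card_dvd_order[OF that(1) _ that(3)] that(2) by (simp add: order_def)
    obtain y where y: "y \<in> D n" "y \<notin> D (Suc n)" "y [^]\<^bsub>?GN\<^esub> p \<in> D (Suc n)"
      using KN.cauchy_modulo[OF finN p(1) dvd[OF p(1) n(1) 3(1)]] by auto
    obtain z where z: "z \<in> D n" "z \<notin> D (Suc n)" "z [^]\<^bsub>?GN\<^esub> q \<in> D (Suc n)"
      using KN.cauchy_modulo[OF finN q(1) dvd[OF q(1) n(2) 3(2)]] by auto
    have "y \<otimes> z \<otimes> inv y \<otimes> inv z \<in> D (Suc n)"
      unfolding suc by (rule N.commutator_closed_derived[OF y(1) z(1)])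
    then have "y \<otimes>\<^bsub>?GN\<^esub> z \<otimes>\<^bsub>?GN\<^esub> inv\<^bsub>?GN\<^esub> y \<otimes>\<^bsub>?GN\<^esub> inv\<^bsub>?GN\<^esub> z \<in> D (Suc n)"
      using m_inv_consistent[OF N.subgroup_axioms] y(1) z(1) by simp
    then obtain g where "g \<in> D n" "group.ord ?GN g = p * q"
      using KN.exists_ord_of_commuting_cosets[OF finN _ _ _ y(2) z(2) y(3) z(3) p(1) q(1) \<open>p \<noteq> q\<close>] y(1) z(1) by auto
    then have False
      using no[of g] ord_subgroup[OF N.subgroup_axioms] N.mem_carrier[of g] by simp
    then show ?thesis ..
  qed
qed

lemma (in group) solvable_exists_abelian_normal:
  assumes "solvable G" "carrier G \<noteq> {\<one>}"
  shows "\<exists>A. A \<lhd> G \<and> A \<noteq> {\<one>} \<and> (\<forall>a\<in>A. \<forall>b\<in>A. a \<otimes> b = b \<otimes> a)"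
proof -
  define D where "D n = (derived G ^^ n) (carrier G)" for n
  define n where "n = (LEAST n. D n = {\<one>})"
  have "\<exists>n. D n = {\<one>}"
    using assms(1) by (auto simp: solvable_iff_trivial_derived_seq D_def)
  then have n: "D n = {\<one>}"
    unfolding n_def by (rule LeastI_ex)
  have "n \<noteq> 0"
  proof
    assume "n = 0"
    then have "D 0 = {\<one>}" using n by simp
    then show False using assms(2) by (simp add: D_def)
  qed
  then obtain k where k: "n = Suc k"
    using not0_implies_Suc by blast
  have "D k \<noteq> {\<one>}"
    using not_less_Least[of k "\<lambda>n. D n = {\<one>}"] k by (auto simp: n_def)
  moreover have normal: "D k \<lhd> G"
    unfolding D_def by (rule derived_power_normal)
  moreover have "a \<otimes> b = b \<otimes> a" if "a \<in> D k" "b \<in> D k" for a b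
  proof (rule commute_if_derived_trivial[OF _ that])
    show "derived G (D k) \<subseteq> {\<one>}"
      using n k by (simp add: D_def)
    show "D k \<subseteq> carrier G"
      by (rule subgroup.subset[OF normal_imp_subgroup[OF normal]])
  qed
  ultimately show ?thesis by blast
qed

text \<open>The prime \<open>s\<close> divides either the order or the index of the centralizer of \<open>H\<close>. In the first case
an element of order \<open>s\<close> commutes with one of order \<open>q\<close>, in the second an involution inverts \<open>H\<close>.\<close>

lemma (in normal) exists_ord_of_even_order_abelian_normal:
  assumes fin: "finite (carrier G)" and ne: "H \<noteq> {\<one>}"
    and comm: "\<And>a b. a \<in> H \<Longrightarrow> b \<in> H \<Longrightarrow> a \<otimes> b = b \<otimes> a"
    and expo: "\<And>e. e \<in> H \<Longrightarrow> e [^] q = \<one>" and q: "prime q" "q \<noteq> 2"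
    and even: "2 dvd order G" and s: "prime s" "s \<noteq> 2" "s \<noteq> q" "s dvd order G"
  shows "\<exists>x\<in>carrier G. ord x = 2 * q \<or> ord x = 2 * s \<or> ord x = s * q"
proof (cases "s dvd card (centralizer H)")
  case True
  then show ?thesis
    using exists_ord_of_dvd_centralizer[OF fin ne expo q(1) s(1,3)] by blast
next
  case False
  interpret C: normal "centralizer H" G by (rule centralizer_normal)
  from C.cauchy_modulo[OF fin s(1) C.prime_times_card_dvd_order[OF s(1,4) False]]
  obtain y where "y \<in> carrier G" "y \<notin> centralizer H" "y [^] s \<in> centralizer H"
    by (elim bexE conjE)
  then have "\<exists>x\<in>carrier G. ord x = 2 * s" if "\<And>x. x \<in> carrier G \<Longrightarrow> ord x \<noteq> 2 * q"
    using exists_ord_of_involution_inverting[OF fin ne comm expo q even that s(1,2)] by simp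
  then show ?thesis by blast
qed

lemma (in group) torsion_of_abelian_normal:
  assumes fin: "finite (carrier G)" and A: "A \<lhd> G" "\<And>a b. a \<in> A \<Longrightarrow> b \<in> A \<Longrightarrow> a \<otimes> b = b \<otimes> a"
    and q: "prime q" "q dvd card A"
  shows "torsion G A q \<lhd> G" "torsion G A q \<noteq> {\<one>}"
    "\<And>e. e \<in> torsion G A q \<Longrightarrow> e [^] q = \<one>"
    "\<And>a b. a \<in> torsion G A q \<Longrightarrow> b \<in> torsion G A q \<Longrightarrow> a \<otimes> b = b \<otimes> a"
proof -
  interpret A: normal A G by fact
  show "torsion G A q \<lhd> G"
    by (rule A.torsion_normal[OF A(2)])
  show "torsion G A q \<noteq> {\<one>}"
    by (rule A.torsion_nontrivial[OF fin q])
qed (use A(2) in \<open>simp_all add: torsion_def\<close>)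

text \<open>The solvable case after passing to a quotient: by minimality, the prime exponent \<open>q\<close> of an abelian
normal subgroup can only be 2, 3 or 5, for otherwise one could divide by it and keep 30 in the order.\<close>

lemma (in group) solvable_exists_ord_6_10_15_reduced:
  assumes fin: "finite (carrier G)" and solv: "solvable G" and ord30: "30 dvd order G"
    and min: "\<And>N. N \<lhd> G \<Longrightarrow> N \<noteq> {\<one>} \<Longrightarrow> \<not> 30 * card N dvd order G"
  shows "\<exists>x\<in>carrier G. ord x \<in> {6, 10, 15}"
proof (rule ccontr)
  assume no: "\<not> ?thesis"
  have primes: "prime (2::nat)" "prime (3::nat)" "prime (5::nat)" by simp_all
  have d: "2 dvd order G" "3 dvd order G" "5 dvd order G"
    using ord30 by (auto elim!: dvd_trans[rotated])
  have "carrier G \<noteq> {\<one>}"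
    using ord30 order_one_triv_iff by auto
  then obtain A where A: "A \<lhd> G" "A \<noteq> {\<one>}" "\<And>a b. a \<in> A \<Longrightarrow> b \<in> A \<Longrightarrow> a \<otimes> b = b \<otimes> a"
    using solvable_exists_abelian_normal[OF solv] by blast
  interpret A: normal A G by fact
  have "card A \<noteq> 1"
    using A(2) A.one_closed card_1_singletonE by (metis singletonD)
  then obtain q where q: "prime q" "q dvd card A"
    using prime_factor_nat by blast
  define E where "E = torsion G A q"
  note E = torsion_of_abelian_normal[OF fin A(1,3) q, folded E_def]
  interpret E: normal E G by (rule E(1))
  have "q = 2 \<or> q = 3 \<or> q = 5"
  proof (rule ccontr)
    assume nq: "\<not> ?thesis"
    have "coprime 30 (card E)"
    proof (rule ccontr)
      assume "\<not> coprime 30 (card E)"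
      then have "gcd 30 (card E) \<noteq> 1" by (simp add: coprime_iff_gcd_eq_1)
      then obtain r where r: "prime r" "r dvd 30" "r dvd card E"
        using prime_factor_nat by (metis dvd_gcdD1 dvd_gcdD2)
      have "r = q"
        using A.prime_dvd_card_torsion[OF fin _ q(1) r(1)] E(1) r(3) by (simp add: E_def)
      moreover have "r dvd 2 * (3 * 5)" using r(2) by simp
      then have "r dvd 2 \<or> r dvd 3 \<or> r dvd 5"
        using r(1) by (metis prime_dvd_multD)
      then have "r = 2 \<or> r = 3 \<or> r = 5"
        using r(1) primes by (metis primes_dvd_imp_eq)
      ultimately show False using nq by simp
    qed
    moreover have "card E dvd order G"
      using E.order_quotient by (metis dvd_triv_right)
    ultimately have "30 * card E dvd order G"
      using ord30 by (intro divides_mult)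
    then show False using min[OF E(1,2)] by simp
  qed
  then consider "q = 2" | "q = 3" | "q = 5" by blast
  then show False
  proof cases
    case 1
    have "\<exists>S x a u v. (u = 5 \<and> v = 3 \<or> u = 3 \<and> v = 5) \<and>
       subgroup S G \<and> card S = u ^ a \<and> a > 0 \<and> x \<in> carrier G \<and> ord x = v \<and> conjugate x S = S"
      by (rule solvable_sylow_normalizing_element[OF fin solv primes(2) d(2) primes(3) d(3)]) (use no in auto)
    then obtain S x a u v where uv: "u = 5 \<and> v = 3 \<or> u = 3 \<and> v = (5::nat)"
      and S: "subgroup S G" "card S = u ^ a" "a > 0" "x \<in> carrier G" "ord x = v" "conjugate x S = S" by blast
    have "prime u" "prime v" "2 \<noteq> u" "2 \<noteq> v" "v \<noteq> u"
      using uv primes by auto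
    then have "\<exists>g\<in>carrier G. ord g = u * 2 \<or> ord g = v * 2 \<or> ord g = v * u"
      using E.frobenius_action_exists_ord[OF fin E(2,4,3) q(1) S(1-3) _ S(4,5) _ S(6)] 1 by simp
    then show False using uv no by auto
  next
    case 2
    have "\<exists>x\<in>carrier G. ord x = 2 * q \<or> ord x = 2 * 5 \<or> ord x = 5 * q"
      using E.exists_ord_of_even_order_abelian_normal[OF fin E(2,4,3) q(1) _ d(1) primes(3)] 2 d(3) by simp
    then show False using 2 no by auto
  next
    case 3
    have "\<exists>x\<in>carrier G. ord x = 2 * q \<or> ord x = 2 * 3 \<or> ord x = 3 * q"
      using E.exists_ord_of_even_order_abelian_normal[OF fin E(2,4,3) q(1) _ d(1) primes(2)] 3 d(2) by simp
    then show False using 3 no by auto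
  qed
qed

lemma (in group) exists_normal_maximal_wrt:
  assumes "finite (carrier G)" "P {\<one>}"
  shows "\<exists>K. K \<lhd> G \<and> P K \<and> (\<forall>N. N \<lhd> G \<longrightarrow> K \<subset> N \<longrightarrow> \<not> P N)"
proof -
  let ?F = "{K. K \<lhd> G \<and> P K}"
  have "?F \<subseteq> Pow (carrier G)"
    using normal_imp_subgroup subgroup.subset by blast
  then have "finite ?F"
    using assms(1) by (auto intro: finite_subset)
  moreover have "{\<one>} \<in> ?F"
    using assms(2) one_is_normal by simp
  ultimately obtain K where "K \<in> ?F" "\<And>N. N \<in> ?F \<Longrightarrow> K \<subseteq> N \<Longrightarrow> N = K"
    using finite_has_maximal2[of ?F "{\<one>}"] by metis
  then show ?thesis by blast
qed

lemma (in normal) Union_normal_of_quotient: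
  assumes fin: "finite (carrier G)" and N: "N \<lhd> G Mod H" "N \<noteq> {\<one>\<^bsub>G Mod H\<^esub>}"
  shows "\<Union>N \<lhd> G" "H \<subset> \<Union>N" "m * card N dvd order (G Mod H) \<Longrightarrow> m * card (\<Union>N) dvd order G"
proof -
  have sN: "subgroup N (G Mod H)"
    using N(1) by (rule normal_imp_subgroup)
  show "\<Union>N \<lhd> G" by (rule factgroup_subgroup_union_normal[OF N(1)])
  have "\<Union>N \<noteq> H"
  proof
    assume "\<Union>N = H"
    then have "N = (\<lambda>x. H #> x) ` H"
      using image_Union_rcosets[OF sN] by simp
    also have "\<dots> = (\<lambda>x. H) ` H"
      by (rule image_cong[OF refl]) (simp add: rcoset_eq_self_iff)
    also have "\<dots> = {H}" by (rule image_constant[OF subgroup.one_closed[OF subgroup_axioms]])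
    finally show False using N(2) by simp
  qed
  then show "H \<subset> \<Union>N"
    using subset_Union_rcosets[OF sN] by blast
  have c: "card (\<Union>N) = card N * card H"
    by (rule card_Union_rcosets[OF fin subgroup.subset[OF sN]])
  show "m * card (\<Union>N) dvd order G" if "m * card N dvd order (G Mod H)"
    using mult_dvd_mono[OF that dvd_refl[of "card H"]] unfolding order_quotient c by (simp add: mult.assoc)
qed

lemma (in group) solvable_exists_ord_6_10_15:
  assumes fin: "finite (carrier G)" and solv: "solvable G" and ord30: "30 dvd order G"
  shows "\<exists>x\<in>carrier G. ord x \<in> {6, 10, 15}"
proof -
  obtain K where K: "K \<lhd> G" "30 * card K dvd order G"
    "\<And>N. N \<lhd> G \<Longrightarrow> K \<subset> N \<Longrightarrow> \<not> 30 * card N dvd order G"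
    using exists_normal_maximal_wrt[OF fin, of "\<lambda>K. 30 * card K dvd order G"] ord30 by auto
  interpret K: normal K G by (rule K(1))
  interpret Q: group "G Mod K" by (rule K.factorgroup_is_group)
  interpret \<pi>: group_hom G "G Mod K" "\<lambda>x. K #> x" by (rule K.coset_hom)
  have finQ: "finite (carrier (G Mod K))"
    using fin by (simp add: carrier_FactGroup)
  have "solvable (G Mod K)"
    using \<pi>.surj_hom_imp_solvable[OF _ solv] by (simp add: carrier_FactGroup)
  moreover have "30 dvd order (G Mod K)"
    using K(2) K.finite_imp_card_positive[OF fin] unfolding K.order_quotient[symmetric] by simp
  moreover have "\<not> 30 * card N dvd order (G Mod K)" if "N \<lhd> G Mod K" "N \<noteq> {\<one>\<^bsub>G Mod K\<^esub>}" for N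
    using K.Union_normal_of_quotient[OF fin that] K(3) by blast
  ultimately obtain C where "C \<in> carrier (G Mod K)" "Q.ord C \<in> {6, 10, 15}"
    using Q.solvable_exists_ord_6_10_15_reduced[OF finQ] by blast
  then show ?thesis
    using K.exists_ord_of_quotient[OF fin] by metis
qed

section \<open>Perfect normal subgroups\<close>

lemma (in group) prime_order_imp_comm_group:
  assumes "prime (order G)"
  shows "comm_group G"
proof -
  have fin: "finite (carrier G)"
    using prime_gt_0_nat[OF assms] by (simp add: order_gt_0_iff_finite)
  obtain x where x: "x \<in> carrier G" "ord x = order G"
    using cauchy[OF fin assms dvd_refl] by (elim bexE)
  have "card (generate G {x}) = card (carrier G)"
    using generate_pow_card[OF x(1)] x(2) by (simp add: order_def)
  then have "generate G {x} = carrier G"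
    using card_subset_eq[OF fin generate_incl] x(1) by simp
  then have "carrier G = range (\<lambda>n::int. x [^] n)"
    unfolding generate_pow[OF x(1)] by (simp add: full_SetCompr_eq)
  then have "cyclic_group G"
    unfolding cyclic_group using x(1) by (intro bexI)
  then show ?thesis
    by (rule cyclic_imp_abelian_group)
qed

text \<open>A quotient of prime order is abelian, and a perfect group has no proper abelian quotient.\<close>

lemma (in group) perfect_head_index:
  assumes fin: "finite (carrier G)" and heads: "prime_or_60_heads G"
    and D: "D \<lhd> G" "derived G D = D" and L: "maximal_normal G L D"
  shows "card D = 60 * card L"
proof -
  interpret D: normal D G by (rule D(1))
  have LD: "L \<lhd> G\<lparr>carrier := D\<rparr>" "L \<noteq> D"
    using L by (auto simp: maximal_normal_def)
  interpret L: normal L "G\<lparr>carrier := D\<rparr>" by (rule LD(1))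
  obtain k where k: "card D = k * card L" "prime k \<or> k = 60"
    using heads D(1) L by (auto simp: prime_or_60_heads_def)
  have "\<not> prime k"
  proof
    assume "prime k"
    have "card L > 0"
      using L.finite_imp_card_positive finite_subset[OF D.subset fin] by simp
    then have "order (G\<lparr>carrier := D\<rparr> Mod L) = k"
      using L.order_quotient k(1) by (simp add: order_def)
    then have "comm_group (G\<lparr>carrier := D\<rparr> Mod L)"
      using group.prime_order_imp_comm_group[OF L.factorgroup_is_group] \<open>prime k\<close> by simp
    then have "D \<subseteq> L"
      using derived_of_subgroup_minimal[OF LD(1) D.subgroup_axioms] D(2) by simp
    then show False
      using L.subset LD(2) by auto
  qed
  then show ?thesis using k by simp
qed

lemma (in group) perfect_index:
  assumes fin: "finite (carrier G)" and heads: "prime_or_60_heads G"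
    and D: "D \<lhd> G" "derived G D = D" and B: "B \<lhd> G\<lparr>carrier := D\<rparr>" "B \<noteq> D"
  shows "60 * card B dvd card D"
proof -
  interpret D: normal D G by (rule D(1))
  have fD: "finite D" by (rule finite_subset[OF D.subset fin])
  obtain L where L: "maximal_normal G L D" "B \<subseteq> L"
    using exists_maximal_normal[OF D.subgroup_axioms fD B] by blast
  have sub: "subgroup L G" "subgroup B G"
    using L(1) B(1) normal_in_subgroup_iff[OF D.subgroup_axioms] by (auto simp: maximal_normal_def)
  have "card B dvd card L"
    using group.lagrange[OF subgroup_imp_group[OF sub(1)] subgroup_incl[OF sub(2,1) L(2)]]
    by (simp add: order_def) (metis dvd_triv_right)
  then show ?thesis
    unfolding perfect_head_index[OF fin heads D L(1)] by simp
qed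

lemma (in normal) rcoset_mult_absorb:
  assumes "x \<in> carrier G" "h \<in> H"
  shows "H #> (x \<otimes> h) = H #> x" "H #> (h \<otimes> x) = H #> x"
proof -
  interpret \<pi>: group_hom G "G Mod H" "\<lambda>x. H #> x" by (rule coset_hom)
  have h: "H #> h = \<one>\<^bsub>G Mod H\<^esub>"
    using assms(2) by (simp add: rcoset_eq_self_iff)
  have "H #> x \<in> carrier (G Mod H)"
    using assms(1) by (simp add: carrier_FactGroup)
  then show "H #> (x \<otimes> h) = H #> x" "H #> (h \<otimes> x) = H #> x"
    using \<pi>.hom_mult[OF assms(1) mem_carrier[OF assms(2)]] \<pi>.hom_mult[OF mem_carrier[OF assms(2)] assms(1)]
      \<pi>.H.r_one \<pi>.H.l_one unfolding h by auto
qed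

lemma (in normal) pow_mem_cong:
  assumes "x \<in> carrier G" "y \<in> carrier G" "H #> x = H #> y"
  shows "x [^] (n::nat) \<in> H \<longleftrightarrow> y [^] n \<in> H"
  using FactGroup_pow[OF assms(1), of n] FactGroup_pow[OF assms(2), of n] assms(3)
    rcoset_eq_self_iff[of "x [^] n"] rcoset_eq_self_iff[of "y [^] n"] assms(1,2) by simp

text \<open>Modulo \<open>A \<inter> B\<close> the factors \<open>A\<close> and \<open>B\<close> commute elementwise. An element of order \<open>r\<close> modulo \<open>B\<close> may be
chosen in \<open>A\<close>, and one of order \<open>s\<close> modulo \<open>A\<close> in \<open>B\<close>, since \<open>A\<close> and \<open>B\<close> together generate the group.\<close>

lemma (in group) exists_ord_of_two_normal_factors:
  assumes fin: "finite (carrier G)" and A: "A \<lhd> G" and B: "B \<lhd> G" and AB: "A <#> B = carrier G"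
    and r: "prime r" "r * card B dvd order G" and s: "prime s" "s * card A dvd order G" and "r \<noteq> s"
  shows "\<exists>g\<in>carrier G. ord g = r * s"
proof -
  interpret A: normal A G by fact
  interpret B: normal B G by fact
  interpret I: normal "A \<inter> B" G by (rule normal_subgroup_intersect[OF A B])
  from B.cauchy_modulo[OF fin r] obtain y where y: "y \<in> carrier G" "y \<notin> B" "y [^] r \<in> B"
    by (elim bexE conjE)
  from A.cauchy_modulo[OF fin s] obtain z where z: "z \<in> carrier G" "z \<notin> A" "z [^] s \<in> A"
    by (elim bexE conjE)
  obtain a b' where a: "a \<in> A" "b' \<in> B" "y = a \<otimes> b'"
    using y(1) unfolding AB[symmetric] set_mult_def by blast
  obtain a' b where b: "a' \<in> A" "b \<in> B" "z = a' \<otimes> b"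
    using z(1) unfolding AB[symmetric] set_mult_def by blast
  have aC: "a \<in> carrier G" using A.mem_carrier[OF a(1)] .
  have bC: "b \<in> carrier G" using B.mem_carrier[OF b(2)] .
  have ya: "B #> y = B #> a"
    unfolding a(3) by (rule B.rcoset_mult_absorb(1)[OF aC a(2)])
  have zb: "A #> z = A #> b"
    unfolding b(3) by (rule A.rcoset_mult_absorb(2)[OF bC b(1)])
  have "a \<notin> B" "a [^] r \<in> B"
    using B.pow_mem_cong[OF y(1) aC ya, of r] B.pow_mem_cong[OF y(1) aC ya, of 1] y aC by auto
  moreover have "b \<notin> A" "b [^] s \<in> A"
    using A.pow_mem_cong[OF z(1) bC zb, of s] A.pow_mem_cong[OF z(1) bC zb, of 1] z bC by auto
  moreover have "a [^] r \<in> A"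
    using A.subgroup_axioms a(1) by (induction r) auto
  moreover have "b [^] s \<in> B"
    using B.subgroup_axioms b(2) by (induction s) auto
  moreover have "a \<otimes> b \<otimes> inv a \<otimes> inv b \<in> A \<inter> B"
  proof
    have "a \<otimes> (b \<otimes> inv a \<otimes> inv b) \<in> A"
      using A.m_closed[OF a(1) A.inv_op_closed2[OF bC A.m_inv_closed[OF a(1)]]] .
    then show "a \<otimes> b \<otimes> inv a \<otimes> inv b \<in> A"
      using aC bC by (simp add: m_assoc)
    show "a \<otimes> b \<otimes> inv a \<otimes> inv b \<in> B"
      using B.m_closed[OF B.inv_op_closed2[OF aC b(2)] B.m_inv_closed[OF b(2)]] .
  qed
  ultimately show ?thesis
    using I.exists_ord_of_commuting_cosets[OF fin aC bC _ _ _ _ _ r(1) s(1) \<open>r \<noteq> s\<close>] by simp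
qed

text \<open>Let \<open>L\<close> be maximal normal in \<open>N\<close>. A conjugate \<open>B \<noteq> L\<close> of \<open>L\<close> would satisfy \<open>L B = N\<close> by maximality, and the
two subgroups of index 60 would produce an element of order 6. So \<open>L\<close> is normal in the whole group, and
minimality of \<open>N\<close> leaves only \<open>L = 1\<close>.\<close>

lemma (in group) minimal_normal_perfect_order_60:
  assumes fin: "finite (carrier G)" and heads: "prime_or_60_heads G"
    and N: "N \<lhd> G" "N \<noteq> {\<one>}" "derived G N = N"
    and min: "\<And>M. M \<lhd> G \<Longrightarrow> M \<subseteq> N \<Longrightarrow> M = {\<one>} \<or> M = N"
    and no6: "\<And>x. x \<in> carrier G \<Longrightarrow> ord x \<noteq> 6"
  shows "card N = 60"
proof -
  interpret N: normal N G by (rule N(1))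
  let ?GN = "G\<lparr>carrier := N\<rparr>"
  interpret GN: group ?GN by (rule subgroup_imp_group[OF N.subgroup_axioms])
  have fN: "finite N" by (rule finite_subset[OF N.subset fin])
  have one: "{\<one>} \<lhd> ?GN"
    using GN.one_is_normal by simp
  obtain L where L: "maximal_normal G L N"
    using exists_maximal_normal[OF N.subgroup_axioms fN one] N(2) by blast
  have LN: "L \<lhd> ?GN" "L \<noteq> N"
    using L by (auto simp: maximal_normal_def)
  have sL: "subgroup L G" "L \<subseteq> N" "\<And>n l. n \<in> N \<Longrightarrow> l \<in> L \<Longrightarrow> n \<otimes> l \<otimes> inv n \<in> L"
    using LN(1) normal_in_subgroup_iff[OF N.subgroup_axioms] by auto
  have LC: "L \<subseteq> carrier G" by (rule subgroup.subset[OF sL(1)])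
  have card: "card N = 60 * card L"
    by (rule perfect_head_index[OF fin heads N(1,3) L])
  have conj: "conjugate g L = L" if g: "g \<in> carrier G" for g
  proof (rule ccontr)
    assume ne: "conjugate g L \<noteq> L"
    let ?B = "conjugate g L"
    have cB: "card ?B = card L" by (rule card_conjugate[OF g LC])
    have BN: "?B \<lhd> ?GN"
      unfolding normal_in_subgroup_iff[OF N.subgroup_axioms]
    proof (intro conjI ballI)
      show "subgroup ?B G" by (rule subgroup_conjugate[OF g sL(1)])
      show "?B \<subseteq> N"
        using sL(2) N.inv_op_closed2[OF g] by (auto simp: conjugate_def)
      fix n b assume n: "n \<in> N" and "b \<in> ?B"
      then obtain l where l: "l \<in> L" "b = g \<otimes> l \<otimes> inv g"
        by (auto simp: conjugate_def)
      let ?n = "inv g \<otimes> n \<otimes> g"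
      have "?n \<otimes> l \<otimes> inv ?n \<in> L"
        using sL(3)[OF N.inv_op_closed1[OF g n] l(1)] .
      moreover have "n \<otimes> b \<otimes> inv n = g \<otimes> (?n \<otimes> l \<otimes> inv ?n) \<otimes> inv g"
        using g N.mem_carrier[OF n] subsetD[OF LC l(1)]
        by (simp add: l(2) m_assoc inv_mult_group inv_cancel_left)
      ultimately show "n \<otimes> b \<otimes> inv n \<in> ?B"
        unfolding conjugate_def by blast
    qed
    have fL: "finite L" by (rule finite_subset[OF sL(2) fN])
    have LB: "L <#>\<^bsub>?GN\<^esub> ?B \<lhd> ?GN"
      by (rule GN.normal_subgroup_set_mult_closed[OF LN(1) BN])
    have BC: "?B \<subseteq> carrier G" by (rule conjugate_closed[OF LC g])
    have one: "\<one> \<in> L" "\<one> \<in> ?B"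
      using subgroup.one_closed[OF sL(1)] subgroup.one_closed[OF subgroup_conjugate[OF g sL(1)]] by auto
    have L_sub: "L \<subseteq> L <#> ?B"
    proof
      fix l assume "l \<in> L"
      then have "l = l \<otimes> \<one>" using LC by auto
      then show "l \<in> L <#> ?B"
        unfolding set_mult_def using \<open>l \<in> L\<close> one(2) by blast
    qed
    have B_sub: "?B \<subseteq> L <#> ?B"
    proof
      fix b assume "b \<in> ?B"
      then have "b = \<one> \<otimes> b" using BC by auto
      then show "b \<in> L <#> ?B"
        unfolding set_mult_def using \<open>b \<in> ?B\<close> one(1) by blast
    qed
    have "L <#> ?B \<noteq> L"
    proof
      assume "L <#> ?B = L"
      then have "?B \<subseteq> L" using B_sub by simp
      then show False using ne card_subset_eq[OF fL _ cB] by blast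
    qed
    then have "L <#>\<^bsub>?GN\<^esub> ?B = carrier ?GN"
      using L LB L_sub unfolding maximal_normal_def by simp blast
    moreover have "3 * card ?B dvd order ?GN" "2 * card L dvd order ?GN"
      unfolding cB by (simp_all add: order_def card)
    ultimately have "\<exists>x\<in>carrier ?GN. group.ord ?GN x = 3 * 2"
      using GN.exists_ord_of_two_normal_factors[OF _ LN(1) BN, of 3 2] fN by simp
    then obtain x where "x \<in> N" "group.ord ?GN x = 6" by auto
    then show False
      using no6[of x] ord_subgroup[OF N.subgroup_axioms] N.mem_carrier by simp
  qed
  have "L \<lhd> G"
  proof (rule normal_invI[OF sL(1)])
    fix x h assume "x \<in> carrier G" "h \<in> L"
    then show "x \<otimes> h \<otimes> inv x \<in> L"
      using conj[of x] unfolding conjugate_def by blast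
  qed
  then have "L = {\<one>}"
    using min[OF _ sL(2)] LN(2) by blast
  then show ?thesis using card by simp
qed

text \<open>A Sylow 2-subgroup \<open>S\<close> of \<open>H\<close> has three nontrivial elements, and \<open>p\<close> is prime to 3. An element
of order \<open>p\<close> normalizing \<open>S\<close> therefore fixes one of them.\<close>

lemma (in normal) order_60_exists_ord:
  assumes fin: "finite (carrier G)" and H: "card H = 60"
    and p: "prime p" "p \<notin> {2, 3, 5}" "p dvd order G"
  shows "\<exists>x\<in>carrier G. ord x = 2 * p"
proof -
  have pH: "\<not> p dvd card H"
  proof
    assume "p dvd card H"
    then have "p dvd 2 * (2 * (3 * 5))" using H by simp
    then have "p dvd 2 \<or> p dvd 3 \<or> p dvd 5"
      using p(1) by (metis prime_dvd_multD)
    moreover have "prime (2::nat)" "prime (3::nat)" "prime (5::nat)" by simp_all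
    ultimately have "p = 2 \<or> p = 3 \<or> p = 5"
      using p(1) by (metis primes_dvd_imp_eq)
    then show False using p(2) by simp
  qed
  have fH: "finite H" by (rule finite_subset[OF subset fin])
  obtain S where S: "subgroup S (G\<lparr>carrier := H\<rparr>)" "card S = 2 ^ 2"
    using sylow_thm[OF two_is_prime_nat subgroup_imp_group[OF subgroup_axioms], of 2 15] fH H
    by (auto simp: order_def)
  have sS: "subgroup S G" "S \<subseteq> H"
    using incl_subgroup[OF subgroup_axioms S(1)] subgroup.subset[OF S(1)] by auto
  interpret S: subgroup S G by (rule sS(1))
  have "\<not> 2 * card S dvd card H"
    unfolding H S(2) by simp
  from frattini[OF fin normal_axioms sS S(2) two_is_prime_nat this p(1,3) pH]
  obtain x where x: "x \<in> carrier G" "ord x = p" "conjugate x S = S"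
    by (elim bexE conjE)
  let ?P = "generate G {x}"
  have sP: "subgroup ?P G"
    using x(1) by (intro generate_is_subgroup) simp
  have "\<exists>e\<in>S - {\<one>}. \<forall>g\<in>carrier (G\<lparr>carrier := ?P\<rparr>). g \<otimes> e \<otimes> inv g = e"
  proof (rule prime_power_action_fixed_point[OF subgroup_imp_group[OF sP] _ p(1)])
    show "order (G\<lparr>carrier := ?P\<rparr>) = p ^ 1"
      using generate_pow_card[OF x(1)] x(2) by (simp add: order_def)
    show "finite (S - {\<one>})"
      using finite_subset[OF S.subset fin] by simp
    have "card (S - {\<one>}) = 3"
      using S(2) subgroup.one_closed[OF sS(1)] by (simp add: card_Diff_singleton)
    then show "\<not> p dvd card (S - {\<one>})"
      using p(1,2) primes_dvd_imp_eq[OF p(1), of 3] by auto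
    show "g \<otimes> e \<otimes> inv g \<in> S - {\<one>}" if "g \<in> carrier (G\<lparr>carrier := ?P\<rparr>)" "e \<in> S - {\<one>}" for g e
    proof -
      have g: "g \<in> ?P" "g \<in> carrier G" and e: "e \<in> S" "e \<in> carrier G" "e \<noteq> \<one>"
        using that subgroup.mem_carrier[OF sP] by auto
      have "g \<otimes> e \<otimes> inv g \<noteq> \<one>"
      proof
        assume "g \<otimes> e \<otimes> inv g = \<one>"
        then have "g \<otimes> e = g"
          using inv_solve_right[of \<one> "g \<otimes> e" g] g(2) e(2) by simp
        then show False using e g(2) by simp
      qed
      then show ?thesis
        using conjugate_generate[OF fin x(1) S.subset x(3) g(1) e(1)] by simp
    qed
    show "\<one>\<^bsub>G\<lparr>carrier := ?P\<rparr>\<^esub> \<otimes> e \<otimes> inv \<one>\<^bsub>G\<lparr>carrier := ?P\<rparr>\<^esub> = e" if "e \<in> S - {\<one>}" for e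
      using that by simp
    show "(g \<otimes>\<^bsub>G\<lparr>carrier := ?P\<rparr>\<^esub> h) \<otimes> e \<otimes> inv (g \<otimes>\<^bsub>G\<lparr>carrier := ?P\<rparr>\<^esub> h) = g \<otimes> (h \<otimes> e \<otimes> inv h) \<otimes> inv g"
      if "g \<in> carrier (G\<lparr>carrier := ?P\<rparr>)" "h \<in> carrier (G\<lparr>carrier := ?P\<rparr>)" "e \<in> S - {\<one>}" for g h e
      using that subgroup.mem_carrier[OF sP] by (simp add: inv_mult_group m_assoc)
  qed
  then obtain e where e: "e \<in> S" "e \<noteq> \<one>" "x \<otimes> e \<otimes> inv x = e"
    using generate.incl[of x "{x}" G] by auto
  have "x \<otimes> e = e \<otimes> x"
    using e inv_solve_right[of e "x \<otimes> e" x] x(1) by simp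
  moreover have "2 dvd ord e"
    by (rule prime_dvd_ord_in_prime_power_subgroup[OF sS(1) S(2) two_is_prime_nat e(1,2)])
  ultimately show ?thesis
    using exists_ord_of_commuting[OF fin S.mem_carrier[OF e(1)] x(1) _ two_is_prime_nat p(1)] x(2) p(2) by auto
qed

section \<open>Nonsolvable groups\<close>

text \<open>The nonsolvable case after passing to a quotient. A minimal normal subgroup \<open>N\<close> is perfect or abelian.
In the abelian case it cannot contain \<open>D\<close>, so by the maximality that led to this quotient \<open>p\<close> divides
\<open>card N\<close>. As there is no element of order \<open>2 * p\<close>, the centralizer of the \<open>p\<close>-torsion of \<open>N\<close> has odd order, whereas \<open>D\<close> has even order; hence the
centralizer meets \<open>D\<close> properly, in a subgroup of index divisible by 60. This provides the
element of order 3 modulo the centralizer that an inverting involution turns into one of order 6.\<close>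

lemma (in group) perfect_exists_ord_reduced:
  assumes fin: "finite (carrier G)" and heads: "prime_or_60_heads G"
    and D: "D \<lhd> G" "derived G D = D" "D \<noteq> {\<one>}"
    and p: "prime p" "p \<notin> {2, 3, 5}" "p dvd order G"
    and min: "\<And>N. N \<lhd> G \<Longrightarrow> N \<noteq> {\<one>} \<Longrightarrow> \<not> D \<subseteq> N \<Longrightarrow> \<not> p * card N dvd order G"
  shows "\<exists>x\<in>carrier G. ord x = 6 \<or> ord x = 2 * p"
proof (rule ccontr)
  assume no: "\<not> ?thesis"
  interpret D: normal D G by (rule D(1))
  define F where "F = {N. N \<lhd> G \<and> N \<noteq> {\<one>}}"
  have "F \<subseteq> Pow (carrier G)"
    using normal_imp_subgroup subgroup.subset unfolding F_def by blast
  then have finF: "finite F"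
    using fin by (auto intro: finite_subset)
  have DF: "D \<in> F" using D by (simp add: F_def)
  obtain N where N': "N \<in> F" "\<forall>M\<in>F. M \<subseteq> N \<longrightarrow> N = M"
    using finite_has_minimal2[OF finF DF] by blast
  then have N: "N \<lhd> G" "N \<noteq> {\<one>}"
    by (simp_all add: F_def)
  have minN: "M = {\<one>} \<or> M = N" if "M \<lhd> G" "M \<subseteq> N" for M
    using N'(2) that by (auto simp: F_def)
  interpret N: normal N G by (rule N(1))
  have "derived G N = {\<one>} \<or> derived G N = N"
    using minN[OF derived_is_normal[OF N(1)] derived_incl[OF order_refl N.subgroup_axioms]] .
  then show False
  proof
    assume "derived G N = N"
    then have "card N = 60"
      using minimal_normal_perfect_order_60[OF fin heads N(1,2) _ minN] no by blast
    from N.order_60_exists_ord[OF fin this p] show False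
      using no by blast
  next
    assume dN: "derived G N = {\<one>}"
    have comm: "a \<otimes> b = b \<otimes> a" if "a \<in> N" "b \<in> N" for a b
      using commute_if_derived_trivial[OF _ that N.subset] dN by simp
    have "\<not> D \<subseteq> N"
    proof
      assume "D \<subseteq> N"
      then have "D \<subseteq> {\<one>}"
        using mono_derived[of D N] D(2) dN by simp
      then show False
        using D(3) subgroup.one_closed[OF D.subgroup_axioms] by blast
    qed
    then have ndvd: "\<not> p * card N dvd order G"
      by (rule min[OF N(1,2)])
    have "p dvd card N"
      using N.prime_times_card_dvd_order[OF p(1,3)] ndvd by blast
    note E = torsion_of_abelian_normal[OF fin N(1) comm p(1) this]
    define E where "E = torsion G N p"
    note E = E[folded E_def]
    interpret E: normal E G by (rule E(1))
    interpret C: normal "centralizer E" G by (rule E.centralizer_normal)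
    let ?GD = "G\<lparr>carrier := D\<rparr>"
    have "{\<one>} \<lhd> ?GD"
      using group.one_is_normal[OF subgroup_imp_group[OF D.subgroup_axioms]] by simp
    then have "60 dvd card D"
      using perfect_index[OF fin heads D(1,2), of "{\<one>}"] D(3) by simp
    moreover have "(2::nat) dvd 60" by simp
    ultimately have evenD: "2 dvd card D"
      using dvd_trans by blast
    have even: "2 dvd order G"
      using evenD D.order_quotient by (metis dvd_mult)
    have p2: "p \<noteq> 2" "2 \<noteq> p" using p(2) by auto
    have oddC: "\<not> 2 dvd card (centralizer E)"
      using E.exists_ord_of_dvd_centralizer[OF fin E(2,3) p(1) two_is_prime_nat p2(2)] no by blast
    have CD: "centralizer E \<inter> D \<lhd> ?GD"
      by (rule normal_Int_subgroup[OF D.subgroup_axioms C.normal_axioms])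
    have "centralizer E \<inter> D \<noteq> D"
    proof
      assume "centralizer E \<inter> D = D"
      then have "D \<subseteq> centralizer E" by blast
      then have "card D dvd card (centralizer E)"
        using group.lagrange[OF subgroup_imp_group[OF C.subgroup_axioms]
            subgroup_incl[OF D.subgroup_axioms C.subgroup_axioms]]
        by (simp add: order_def) (metis dvd_triv_right)
      then show False
        using evenD oddC dvd_trans by blast
    qed
    then have d60: "60 * card (centralizer E \<inter> D) dvd card D"
      by (rule perfect_index[OF fin heads D(1,2) CD])
    have d3: "3 * card (centralizer E \<inter> D) dvd 60 * card (centralizer E \<inter> D)"
      by (rule mult_dvd_mono) simp_all
    have "order ?GD = card D" by (simp add: order_def)
    then have three: "3 * card (centralizer E \<inter> D) dvd order ?GD"
      using dvd_trans[OF d3 d60] by (rule ssubst)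
    have "prime (3::nat)" by simp
    from normal.cauchy_modulo[OF CD _ this three] finite_subset[OF D.subset fin]
    obtain y where "y \<in> D" "y \<notin> centralizer E \<inter> D" "y [^]\<^bsub>?GD\<^esub> (3::nat) \<in> centralizer E \<inter> D"
      by auto
    then have y: "y \<in> carrier G" "y \<notin> centralizer E" "y [^] (3::nat) \<in> centralizer E"
      by (simp_all flip: nat_pow_consistent)
    have "\<exists>x\<in>carrier G. ord x = 2 * 3"
      using E.exists_ord_of_involution_inverting[OF fin E(2,4,3) p(1) p2(1) even _ _ _ y] no by simp
    then show False using no by simp
  qed
qed

lemma (in group) exists_perfect_normal_if_not_solvable:
  assumes fin: "finite (carrier G)" and "\<not> solvable G"
  shows "\<exists>D. D \<lhd> G \<and> derived G D = D \<and> D \<noteq> {\<one>}"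
proof -
  define D where "D n = (derived G ^^ n) (carrier G)" for n
  have DN: "D n \<lhd> G" for n
    unfolding D_def by (rule derived_power_normal)
  obtain n where n: "\<And>m. card (D n) \<le> card (D m)"
    using ex_has_least_nat[of "\<lambda>_. True" 0 "\<lambda>n. card (D n)"] by blast
  have sub: "subgroup (D n) G"
    using DN by (rule normal_imp_subgroup)
  have suc: "D (Suc n) = derived G (D n)" by (simp add: D_def)
  have "derived G (D n) = D n"
  proof (rule card_seteq)
    show "finite (D n)" by (rule finite_subset[OF subgroup.subset[OF sub] fin])
    show "derived G (D n) \<subseteq> D n" by (rule derived_incl[OF order_refl sub])
    show "card (D n) \<le> card (derived G (D n))" using n[of "Suc n"] unfolding suc .
  qed
  moreover have "D n \<noteq> {\<one>}"
    using assms(2) unfolding solvable_iff_trivial_derived_seq D_def by blast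
  ultimately show ?thesis using DN by blast
qed

lemma (in group) nonsolvable_exists_ord:
  assumes fin: "finite (carrier G)" and heads: "prime_or_60_heads G" and "\<not> solvable G"
    and p: "prime p" "p \<notin> {2, 3, 5}" "p dvd order G"
  shows "\<exists>x\<in>carrier G. ord x = 6 \<or> ord x = 2 * p"
proof -
  obtain D where D: "D \<lhd> G" "derived G D = D" "D \<noteq> {\<one>}"
    using exists_perfect_normal_if_not_solvable[OF fin assms(3)] by blast
  interpret D: normal D G by (rule D(1))
  have "\<not> D \<subseteq> {\<one>}"
    using D(3) subgroup.one_closed[OF D.subgroup_axioms] by blast
  then obtain K where K: "K \<lhd> G" "p * card K dvd order G" "\<not> D \<subseteq> K"
    "\<And>N. N \<lhd> G \<Longrightarrow> K \<subset> N \<Longrightarrow> \<not> D \<subseteq> N \<Longrightarrow> \<not> p * card N dvd order G"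
    using exists_normal_maximal_wrt[OF fin, of "\<lambda>K. p * card K dvd order G \<and> \<not> D \<subseteq> K"] p(3) by auto
  interpret K: normal K G by (rule K(1))
  let ?Q = "G Mod K"
  interpret Q: group ?Q by (rule K.factorgroup_is_group)
  interpret \<pi>: group_hom G ?Q "\<lambda>x. K #> x" by (rule K.coset_hom)
  have finQ: "finite (carrier ?Q)"
    using fin by (simp add: carrier_FactGroup)
  let ?D = "(\<lambda>x. K #> x) ` D"
  have D1: "?D \<lhd> ?Q"
    by (rule D.surj_hom_normal_subgroup[OF K.coset_hom]) (simp add: carrier_FactGroup)
  have D2: "derived ?Q ?D = ?D"
    using \<pi>.derived_img[OF D.subset] D(2) by simp
  have D3: "?D \<noteq> {\<one>\<^bsub>?Q\<^esub>}"
  proof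
    assume *: "?D = {\<one>\<^bsub>?Q\<^esub>}"
    have "d \<in> K" if "d \<in> D" for d
    proof -
      have "K #> d \<in> ?D" using that by (rule imageI)
      then have "K #> d = K" unfolding * by simp
      then show ?thesis
        using K.rcoset_eq_self_iff[OF D.mem_carrier[OF that]] by simp
    qed
    then show False using K(3) by blast
  qed
  have pQ: "p dvd order ?Q"
    using K(2) K.finite_imp_card_positive[OF fin] unfolding K.order_quotient[symmetric] by simp
  have max: "\<not> p * card N dvd order ?Q" if N: "N \<lhd> ?Q" "N \<noteq> {\<one>\<^bsub>?Q\<^esub>}" "\<not> ?D \<subseteq> N" for N
  proof -
    note U = K.Union_normal_of_quotient[OF fin N(1,2)]
    have "\<not> D \<subseteq> \<Union>N"
    proof
      assume "D \<subseteq> \<Union>N"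
      then have "?D \<subseteq> (\<lambda>x. K #> x) ` (\<Union>N)" by (rule image_mono)
      then show False
        using N(3) unfolding K.image_Union_rcosets[OF normal_imp_subgroup[OF N(1)]] by simp
    qed
    then show ?thesis
      using K(4)[OF U(1,2)] U(3)[of p] by blast
  qed
  have "\<exists>C\<in>carrier ?Q. Q.ord C = 6 \<or> Q.ord C = 2 * p"
    by (rule Q.perfect_exists_ord_reduced[OF finQ K.prime_or_60_heads_quotient[OF fin heads] D1 D2 D3 p(1,2) pQ])
      (rule max)
  then obtain C where C: "C \<in> carrier ?Q" "Q.ord C = 6 \<or> Q.ord C = 2 * p"
    by (elim bexE)
  obtain x where "x \<in> carrier G" "ord x = Q.ord C"
    using K.exists_ord_of_quotient[OF fin C(1)] by (elim bexE)
  then show ?thesis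
    using C(2) by auto
qed

section \<open>Heads of pseudo-solvable groups\<close>

lemma (in normal) simple_quotient_if_maximal:
  assumes fin: "finite (carrier G)" and ne: "H \<noteq> carrier G"
    and max: "\<And>M. M \<lhd> G \<Longrightarrow> H \<subseteq> M \<Longrightarrow> M = H \<or> M = carrier G"
  shows "simple_group (G Mod H)"
proof (intro simple_group.intro simple_group_axioms.intro factorgroup_is_group)
  have "card H < order G"
    using psubset_card_mono[OF fin, of H] subset ne by (auto simp: order_def)
  then show "1 < order (G Mod H)"
    using order_quotient by (cases "order (G Mod H) \<le> 1") (auto simp: le_Suc_eq)
next
  fix N assume N: "N \<lhd> G Mod H"
  have sN: "subgroup N (G Mod H)" using N by (rule normal_imp_subgroup)
  show "N = carrier (G Mod H) \<or> N = {\<one>\<^bsub>G Mod H\<^esub>}"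
  proof (cases "N = {\<one>\<^bsub>G Mod H\<^esub>}")
    case False
    have "\<Union>N = carrier G"
      using max[OF Union_normal_of_quotient(1)[OF fin N False]] Union_normal_of_quotient(2)[OF fin N False] by blast
    then have "N = (\<lambda>x. H #> x) ` carrier G"
      using image_Union_rcosets[OF sN] by simp
    then show ?thesis by (simp add: carrier_FactGroup)
  qed simp
qed

lemma (in group) maximal_normal_imp_simple:
  assumes "subgroup N G" "finite N" "maximal_normal G L N"
  shows "simple_group (G\<lparr>carrier := N\<rparr> Mod L)"
  using assms(2,3) by (intro normal.simple_quotient_if_maximal) (auto simp: maximal_normal_def)

text \<open>A composition series without conditions on its two ends, so that it can be built up from the bottom.\<close>

definition subnormal_series :: "('a, 'b) monoid_scheme \<Rightarrow> 'a set list \<Rightarrow> bool" where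
  "subnormal_series G Hs \<longleftrightarrow> Hs \<noteq> [] \<and>
     (\<forall>i. Suc i < length Hs \<longrightarrow>
        Hs ! i \<lhd> G\<lparr>carrier := Hs ! Suc i\<rparr> \<and> simple_group (G\<lparr>carrier := Hs ! Suc i\<rparr> Mod Hs ! i))"

lemma subnormal_series_snoc:
  assumes "subnormal_series G Hs" "last Hs \<lhd> G\<lparr>carrier := N\<rparr>" "simple_group (G\<lparr>carrier := N\<rparr> Mod last Hs)"
  shows "subnormal_series G (Hs @ [N])"
  unfolding subnormal_series_def
proof (intro conjI allI impI)
  fix i assume i: "Suc i < length (Hs @ [N])"
  show "(Hs @ [N]) ! i \<lhd> G\<lparr>carrier := (Hs @ [N]) ! Suc i\<rparr>"
    "simple_group (G\<lparr>carrier := (Hs @ [N]) ! Suc i\<rparr> Mod (Hs @ [N]) ! i)"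
  proof -
    consider "Suc i < length Hs" | "Suc i = length Hs" using i by fastforce
    then have "(Hs @ [N]) ! i \<lhd> G\<lparr>carrier := (Hs @ [N]) ! Suc i\<rparr> \<and>
      simple_group (G\<lparr>carrier := (Hs @ [N]) ! Suc i\<rparr> Mod (Hs @ [N]) ! i)"
    proof cases
      case 1
      then show ?thesis
        using assms(1) by (simp add: subnormal_series_def nth_append)
    next
      case 2
      then have "(Hs @ [N]) ! i = last Hs" "(Hs @ [N]) ! Suc i = N"
        using assms(1) by (simp_all add: subnormal_series_def nth_append last_conv_nth flip: 2)
      then show ?thesis using assms(2,3) by simp
    qed
    then show "(Hs @ [N]) ! i \<lhd> G\<lparr>carrier := (Hs @ [N]) ! Suc i\<rparr>"
      "simple_group (G\<lparr>carrier := (Hs @ [N]) ! Suc i\<rparr> Mod (Hs @ [N]) ! i)" by blast+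
  qed
qed simp

text \<open>Descending from \<open>N\<close> through maximal normal subgroups that contain the last member reaches that member
after finitely many steps; these steps, reversed, are the extension.\<close>

lemma (in group) subnormal_series_extend:
  assumes fin: "finite (carrier G)" and Hs: "subnormal_series G Hs"
    and N: "subgroup N G" "last Hs \<lhd> G\<lparr>carrier := N\<rparr>"
  shows "\<exists>Ks. subnormal_series G (Hs @ Ks) \<and> last (Hs @ Ks) = N"
  using N
proof (induction "card N" arbitrary: N rule: less_induct)
  case less
  have fN: "finite N" by (rule finite_subset[OF subgroup.subset[OF less.prems(1)] fin])
  show ?case
  proof (cases "last Hs = N")
    case True
    then show ?thesis
      using Hs by (intro exI[of _ "[]"]) simp
  next
    case False
    obtain L where L: "maximal_normal G L N" "last Hs \<subseteq> L"
      using exists_maximal_normal[OF less.prems(1) fN less.prems(2) False] by blast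
    have LN: "L \<lhd> G\<lparr>carrier := N\<rparr>" "L \<noteq> N"
      using L(1) by (simp_all add: maximal_normal_def)
    have sL: "subgroup L G" "L \<subseteq> N"
      using LN(1) normal_in_subgroup_iff[OF less.prems(1)] by simp_all
    have "card L < card N"
      using psubset_card_mono[OF fN] sL(2) LN(2) by blast
    moreover have "last Hs \<lhd> G\<lparr>carrier := L\<rparr>"
      using less.prems(2) L(2) sL(2) unfolding normal_in_subgroup_iff[OF less.prems(1)] normal_in_subgroup_iff[OF sL(1)] by blast
    ultimately obtain Ks where Ks: "subnormal_series G (Hs @ Ks)" "last (Hs @ Ks) = L"
      using less.hyps sL(1) by blast
    have "subnormal_series G ((Hs @ Ks) @ [N])"
      using subnormal_series_snoc[OF Ks(1), of N] LN(1) maximal_normal_imp_simple[OF less.prems(1) fN L(1)]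
      by (simp only: Ks(2))
    then show ?thesis
      by (intro exI[of _ "Ks @ [N]"]) simp
  qed
qed

text \<open>A series from the trivial subgroup to \<open>L\<close>, continued by \<open>N\<close> and then up to the whole group, is a
composition series in which \<open>L\<close> and \<open>N\<close> are neighbours.\<close>

lemma (in group) head_in_composition_factors:
  assumes fin: "finite (carrier G)" and N: "N \<lhd> G" and L: "maximal_normal G L N"
  shows "G\<lparr>carrier := N\<rparr> Mod L \<in> composition_factors G"
proof -
  have sN: "subgroup N G" using N by (rule normal_imp_subgroup)
  have fN: "finite N" by (rule finite_subset[OF subgroup.subset[OF sN] fin])
  have LN: "L \<lhd> G\<lparr>carrier := N\<rparr>"
    using L by (simp add: maximal_normal_def)
  then have sL: "subgroup L G"
    using normal_in_subgroup_iff[OF sN] by simp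
  have "subnormal_series G [{\<one>}]"
    by (simp add: subnormal_series_def)
  moreover have "last [{\<one>}] \<lhd> G\<lparr>carrier := L\<rparr>"
    using group.one_is_normal[OF subgroup_imp_group[OF sL]] by simp
  ultimately obtain Ks where Ks: "subnormal_series G ([{\<one>}] @ Ks)" "last ([{\<one>}] @ Ks) = L"
    using subnormal_series_extend[OF fin _ sL] by blast
  define Hs where "Hs = ([{\<one>}] @ Ks)"
  have "subnormal_series G (Hs @ [N])"
    using subnormal_series_snoc[OF Ks(1), of N] LN maximal_normal_imp_simple[OF sN fN L]
    by (simp only: Ks(2) Hs_def)
  moreover have "last (Hs @ [N]) \<lhd> G\<lparr>carrier := carrier G\<rparr>"
    using N by simp
  ultimately obtain Js where Js: "subnormal_series G ((Hs @ [N]) @ Js)" "last ((Hs @ [N]) @ Js) = carrier G"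
    using subnormal_series_extend[OF fin _ subgroup_self] by blast
  let ?S = "(Hs @ [N]) @ Js"
  have "composition_series G ?S"
    using Js by (simp add: composition_series_def subnormal_series_def Hs_def)
  moreover have "Suc (length Ks) < length ?S" by (simp add: Hs_def)
  moreover have "?S ! length Ks = L"
    using Ks(2) by (simp add: Hs_def nth_append last_conv_nth nth_Cons' split: if_splits)
  moreover have "?S ! Suc (length Ks) = N"
    by (simp add: Hs_def nth_append)
  ultimately show ?thesis
    unfolding composition_factors_def mem_Collect_eq
    by (intro exI[of _ ?S] exI[of _ "length Ks"]) (simp only: simp_thms)
qed

lemma (in simple_group) comm_imp_prime_order:
  assumes "finite (carrier G)" "comm_group G"
  shows "prime (order G)"
proof -
  obtain p where p: "prime p" "p dvd order G"
    using prime_factor_nat[of "order G"] order_gt_one by auto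
  obtain x where x: "x \<in> carrier G" "ord x = p"
    using cauchy[OF assms(1) p] by (elim bexE)
  have "generate G {x} \<lhd> G"
    using x(1) by (intro comm_group.subgroup_imp_normal[OF assms(2)] generate_is_subgroup) simp
  then have "generate G {x} = carrier G \<or> generate G {x} = {\<one>}"
    by (rule no_real_normal_subgroup)
  moreover have "card (generate G {x}) = p"
    using generate_pow_card[OF x(1)] x(2) by simp
  ultimately show ?thesis
    using p(1) by (auto simp: order_def)
qed

lemma order_alt_group_5: "order (alt_group 5) = 60"
proof -
  have "2 * card (carrier (alt_group 5)) = fact 5"
    using alt_group_card_carrier[of 5] by simp
  then show ?thesis
    by (simp add: order_def fact_numeral)
qed

lemma pseudo_solvable_imp_prime_or_60_heads:
  assumes "pseudo_solvable G"
  shows "prime_or_60_heads G"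
  unfolding prime_or_60_heads_def
proof (intro allI impI)
  fix N L assume N: "N \<lhd> G" and L: "maximal_normal G L N"
  interpret group G using assms by (simp add: pseudo_solvable_def)
  have fin: "finite (carrier G)" using assms by (simp add: pseudo_solvable_def)
  have sN: "subgroup N G" using N by (rule normal_imp_subgroup)
  have fN: "finite N" by (rule finite_subset[OF subgroup.subset[OF sN] fin])
  let ?F = "G\<lparr>carrier := N\<rparr> Mod L"
  interpret L: normal L "G\<lparr>carrier := N\<rparr>"
    using L by (simp add: maximal_normal_def)
  interpret F: simple_group ?F
    by (rule maximal_normal_imp_simple[OF sN fN L])
  have finF: "finite (carrier ?F)"
    using fN by (simp add: carrier_FactGroup)
  have "cyclic_group ?F \<or> ?F \<cong> alt_group 5"
    using head_in_composition_factors[OF fin N L] assms by (simp add: pseudo_solvable_def)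
  then have "prime (order ?F) \<or> order ?F = 60"
  proof
    assume "cyclic_group ?F"
    then show ?thesis
      using F.comm_imp_prime_order[OF finF F.cyclic_imp_abelian_group] by simp
  next
    assume "?F \<cong> alt_group 5"
    then have "card (carrier ?F) = card (carrier (alt_group 5))"
      by (rule iso_same_card)
    then show ?thesis
      using order_alt_group_5 by (simp add: order_def)
  qed
  moreover have "card N = order ?F * card L"
    using L.order_quotient by (simp add: order_def)
  ultimately show "\<exists>k. card N = k * card L \<and> (prime k \<or> k = 60)"
    by blast
qed

section \<open>The complement of the prime graph\<close>

theorem theorem6p8:
  fixes G :: "('a, 'b) monoid_scheme"
  assumes "group G" and "finite (carrier G)" and "pseudo_solvable G"
  shows "\<not> forms_triangle {2, 3, 5} (graph_complement (prime_graph G)) \<or>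
         (\<forall>p. prime p \<and> p \<notin> {2, 3, 5} \<longrightarrow> (2, p) \<notin> parcs (graph_complement (prime_graph G)))"
proof (rule ccontr)
  assume *: "\<not> ?thesis"
  interpret group G by fact
  obtain p where tri: "forms_triangle {2, 3, 5} (graph_complement (prime_graph G))"
    and p: "prime p" "p \<notin> {2, 3, 5}" and edge: "(2, p) \<in> parcs (graph_complement (prime_graph G))"
    using * by blast
  have no: "ord x \<noteq> q * r" if "(q, r) \<in> parcs (graph_complement (prime_graph G))" "x \<in> carrier G" for q r x
    using that by (auto simp: graph_complement_def prime_graph_def Let_def)
  have pd: "p dvd order G"
    using edge by (auto simp: graph_complement_def prime_graph_def Let_def)
  have d: "2 dvd order G" "3 dvd order G" "5 dvd order G"
    using tri by (auto simp: forms_triangle_def graph_complement_def prime_graph_def Let_def)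
  have edges: "(2, 3) \<in> parcs (graph_complement (prime_graph G))" "(2, 5) \<in> parcs (graph_complement (prime_graph G))"
    "(3, 5) \<in> parcs (graph_complement (prime_graph G))"
    using tri by (simp_all add: forms_triangle_def)
  show False
  proof (cases "solvable G")
    case True
    have "2 * 3 dvd order G"
      using d(1,2) by (intro divides_mult) (simp_all add: primes_coprime)
    moreover have "coprime (2 * 3) (5::nat)"
      unfolding coprime_mult_left_iff by (simp add: primes_coprime)
    ultimately have "2 * 3 * 5 dvd order G"
      using divides_mult[of "2 * 3" "order G" 5] d(3) by blast
    then have "30 dvd order G" by simp
    then obtain x where "x \<in> carrier G" "ord x \<in> {6, 10, 15}"
      using solvable_exists_ord_6_10_15[OF assms(2) True] by blast
    then show False
      using no[OF edges(1), of x] no[OF edges(2), of x] no[OF edges(3), of x] by auto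
  next
    case False
    from nonsolvable_exists_ord[OF assms(2) pseudo_solvable_imp_prime_or_60_heads[OF assms(3)] False p pd]
    obtain x where "x \<in> carrier G" "ord x = 6 \<or> ord x = 2 * p" by (elim bexE)
    then show False
      using no[OF edges(1), of x] no[OF edge, of x] by auto
  qed
qed

end
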